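(* Let $A=A(z^2)$. The $\mathbb{Z}_{\mathrm{fin}}$-graded ring $B=\bigoplus_{J\in\mathbb{Z}_{\mathrm{fin}}}\operatorname{Hom}_{\operatorname{gr}\text{-}A}(A,\iota_JA)$ has presentation $$B\cong\frac{\Bbbk[z][b_n\mid n\in\mathbb{Z}]}{\left(b_n^2=(z+n)^2\mid n\in\mathbb{Z}\right)},$$ where $\deg z=\emptyset$ and $\deg b_n=n$ (that is, $\{n\}$).
   Context: $\Bbbk$ is an algebraically closed field of characteristic zero. $\mathbb{Z}_{\mathrm{fin}}$ is the group of finite subsets of $\mathbb{Z}$ under symmetric difference $\oplus$; a singleton $\{n\}$ is written $n$. $A=A(z^2)$ is the $\Bbbk$-algebra generated over $\Bbbk[z]$ by $x,y$ with relations $xz=(z+1)x$, $yz=(z-1)y$, $xy=z^2$, $yx=(z-1)^2$, with $\mathbb{Z}$-grading $\deg x=1$, $\deg y=-1$, $\deg z=0$. $\operatorname{gr}\text{-}A$ is the category of finitely generated $\mathbb{Z}$-graded right $A$-modules with degree-preserving homomorphisms. Shifts: $M\langle n\rangle_i=M_{i-n}$. Put $X=A/(x,z)A$ and $Y=(A/(y,z-1)A)\langle 1\rangle$. The graded quotient ring of $A$ is $Q_{\mathrm{gr}}(A)=\Bbbk(z)[x^{\pm1};\sigma]$, $\sigma(z)=z+1$. Rank one graded projective $A$-modules are regarded as graded submodules of $Q_{\mathrm{gr}}(A)$; graded homomorphisms between them are given by left multiplication by elements of $\Bbbk(z)$. Each rank one graded projective $P$ surjects, for each $n\in\mathbb{Z}$,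 onto exactly one of $X\langle n\rangle$, $Y\langle n\rangle$. For $n\in\mathbb{Z}$, $\iota_n$ is the autoequivalence of $\operatorname{gr}\text{-}A$ (constructed in earlier work of the author) swapping $X\langle n\rangle$ and $Y\langle n\rangle$ up to isomorphism and fixing all other simples. On a rank one graded projective $P$, $\iota_nP\subseteq P$ is the kernel of a surjective graded homomorphism $P\to(A/xA)\langle n\rangle$ if $P$ surjects onto $X\langle n\rangle$, and $P\to(A/yA)\langle n+1\rangle$ if $P$ surjects onto $Y\langle n\rangle$; on morphisms between rank one projectives $\iota_n$ acts by restriction. The $\iota_n$ commute and $\iota_n^2P=(z+n)^2P$. For $J\in\mathbb{Z}_{\mathrm{fin}}$ put $\iota_J=\prod_{j\in J}\iota_j$, $\iota_\emptyset=\operatorname{Id}$, and $h_J=\prod_{j\in J}(z+j)^2$, $h_\emptyset=1$. Let $\sigma_J:\iota_J^2A\to A$ be left multiplication by $h_J^{-1}$. Multiplication in $B$: for $a\in B_I=\operatorname{Hom}_{\operatorname{gr}\text{-}A}(A,\iota_IA)$ and $b\in B_J$, $a\cdot b=\iota_{I\oplus J}(\sigma_{I\cap J})\circ\iota_J(a)\circ b\in B_{I\oplus J}$. In the presentation, $z$ corresponds to the element of $B_\emptyset=\operatorname{Hom}_{\operatorname{gr}\text{-}A}(A,A)$ given by left multiplication by $z$, and $b_n$ to the element of $B_n=\operatorname{Hom}_{\operatorname{gr}\text{-}A}(A,\iota_nA)$ given by left multiplication by $h_n=(z+n)^2$. *)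

theory Defs
  imports
    "HOL-Library.FSet"
    "HOL-Library.Poly_Mapping"
    "HOL-Computational_Algebra.Polynomial_Factorial"
    "HOL-Algebra.QuotRing"
begin

section \<open>Rings given by generators and relations\<close>

definition univ_ring :: "'a::ring_1 ring" where
  "univ_ring = \<lparr>carrier = UNIV, mult = (*), one = 1, zero = 0, add = (+)\<rparr>"

lemma univ_ring_simps [simp]:
  "carrier univ_ring = UNIV" "x \<otimes>\<^bsub>univ_ring\<^esub> y = x * y" "\<one>\<^bsub>univ_ring\<^esub> = 1"
  "x \<oplus>\<^bsub>univ_ring\<^esub> y = x + y" "\<zero>\<^bsub>univ_ring\<^esub> = 0"
  by (simp_all add: univ_ring_def)

lemma ring_univ_ring: "ring (univ_ring :: 'a::ring_1 ring)"
proof (rule ringI)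
  show "abelian_group (univ_ring :: 'a ring)"
  proof (rule abelian_groupI)
    fix x :: 'a
    show "\<exists>y\<in>carrier univ_ring. y \<oplus>\<^bsub>univ_ring\<^esub> x = \<zero>\<^bsub>univ_ring\<^esub>"
      by (rule bexI[of _ "- x"]) simp_all
  qed (simp_all add: algebra_simps)
  show "Group.monoid (univ_ring :: 'a ring)"
    by (rule Group.monoidI) (simp_all add: algebra_simps)
qed (simp_all add: algebra_simps)

definition presented_ring :: "'a::ring_1 set \<Rightarrow> 'a set ring" where
  "presented_ring S = univ_ring Quot (genideal univ_ring S)"

definition presented_class :: "'a::ring_1 set \<Rightarrow> 'a \<Rightarrow> 'a set" where
  "presented_class S p = genideal univ_ring S +>\<^bsub>univ_ring\<^esub> p"

lemma ring_presented_ring: "ring (presented_ring S)"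
  unfolding presented_ring_def
  by (rule ideal.quotient_is_ring, rule ring.genideal_ideal[OF ring_univ_ring]) simp


section \<open>The algebra \<open>A(z\<^sup>2)\<close>\<close>

datatype gen = GX | GY | GZ

text \<open>Words under concatenation, so that \<open>gen list \<Rightarrow>\<^sub>0 'k\<close> with the convolution product of
  \<^theory>\<open>HOL-Library.Poly_Mapping\<close> is the free associative algebra on \<open>x, y, z\<close>.\<close>

instantiation list :: (type) monoid_add
begin
definition zero_list :: "'a list" where "zero_list = []"
definition plus_list :: "'a list \<Rightarrow> 'a list \<Rightarrow> 'a list" where "plus_list = (@)"
instance by standard (simp_all add: zero_list_def plus_list_def)
end

type_synonym 'k free_alg = "gen list \<Rightarrow>\<^sub>0 'k"

definition fgen :: "gen \<Rightarrow> 'k::field free_alg" where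
  "fgen g = Poly_Mapping.single [g] 1"

definition A_rels :: "'k::field free_alg set" where
  "A_rels = (let x = fgen GX; y = fgen GY; z = fgen GZ in
     {x * z - (z + 1) * x, y * z - (z - 1) * y, x * y - z ^ 2, y * x - (z - 1) ^ 2})"

definition algA :: "'k::field free_alg set ring" where
  "algA = presented_ring A_rels"

abbreviation A_class :: "'k::field free_alg \<Rightarrow> 'k free_alg set" where
  "A_class \<equiv> presented_class A_rels"

fun gen_deg :: "gen \<Rightarrow> int" where
  "gen_deg GX = 1" | "gen_deg GY = - 1" | "gen_deg GZ = 0"

definition A_comp :: "int \<Rightarrow> 'k::field free_alg set set" where
  "A_comp i = A_class ` {p. \<forall>w\<in>Poly_Mapping.keys p. (\<Sum>g\<leftarrow>w. gen_deg g) = i}"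


section \<open>The graded quotient ring \<open>k(z)[x\<^sup>\<plusminus>\<^sup>1; \<sigma>]\<close>\<close>

text \<open>\<open>zshift i\<close> is \<open>\<sigma>\<^sup>i\<close>, the automorphism \<open>z \<mapsto> z + i\<close> of \<open>k(z)\<close>.\<close>

definition zshift :: "int \<Rightarrow> 'k::field poly fract \<Rightarrow> 'k poly fract" where
  "zshift i r = (THE s. \<exists>p q. q \<noteq> 0 \<and> r = Fract p q \<and>
     s = Fract (pcompose p [:of_int i, 1:]) (pcompose q [:of_int i, 1:]))"

lemma zshift_Fract:
  assumes "q \<noteq> 0"
  shows "zshift i (Fract p q) = Fract (pcompose p [:of_int i, 1:]) (pcompose q [:of_int i, 1:])"
  unfolding zshift_def
proof (rule the_equality)
  fix s
  assume "\<exists>p' q'. q' \<noteq> 0 \<and> Fract p q = Fract p' q' \<and>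
    s = Fract (pcompose p' [:of_int i, 1:]) (pcompose q' [:of_int i, 1:])"
  then obtain p' q' where *: "q' \<noteq> 0" "Fract p q = Fract p' q'"
    "s = Fract (pcompose p' [:of_int i, 1:]) (pcompose q' [:of_int i, 1:])" by blast
  have "p * q' = p' * q" using * assms by (simp add: eq_fract)
  hence "pcompose (p * q') [:of_int i, 1:] = pcompose (p' * q) [:of_int i, 1:]" by simp
  thus "s = Fract (pcompose p [:of_int i, 1:]) (pcompose q [:of_int i, 1:])"
    using * assms by (simp add: eq_fract pcompose_mult pcompose_eq_0_iff)
qed (use assms in blast)

lemma zshift_add: "zshift i (a + b) = zshift i a + zshift i b"
  by (cases a, cases b) (simp add: zshift_Fract pcompose_mult pcompose_add pcompose_eq_0_iff)

lemma zshift_mult: "zshift i (a * b) = zshift i a * zshift i b"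
  by (cases a, cases b) (simp add: zshift_Fract pcompose_mult)

lemma zshift_0 [simp]: "zshift i 0 = 0"
  by (simp add: Zero_fract_def zshift_Fract pcompose_1)

lemma zshift_1 [simp]: "zshift i 1 = 1"
  by (simp add: One_fract_def zshift_Fract pcompose_1)

lemma zshift_zero_left [simp]: "zshift 0 a = a"
  by (cases a) (simp add: zshift_Fract)

lemma zshift_zshift: "zshift i (zshift j a) = zshift (i + j) a"
  by (cases a)
     (simp add: zshift_Fract pcompose_eq_0_iff pcompose_assoc[symmetric] pcompose_pCons add.commute)

text \<open>The element \<open>\<Sum> f\<^sub>i x\<^sup>i\<close> is represented by the finitely supported map \<open>i \<mapsto> f\<^sub>i\<close>. The
  copy \<open>qgr\<close> is needed since \<^typ>\<open>int \<Rightarrow>\<^sub>0 'a\<close> already carries the untwisted product.\<close>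

definition skew_times ::
  "(int \<Rightarrow>\<^sub>0 'k::field poly fract) \<Rightarrow> (int \<Rightarrow>\<^sub>0 'k poly fract) \<Rightarrow> (int \<Rightarrow>\<^sub>0 'k poly fract)" where
  "skew_times a b = (\<Sum>i\<in>Poly_Mapping.keys a. \<Sum>j\<in>Poly_Mapping.keys b.
     Poly_Mapping.single (i + j) (Poly_Mapping.lookup a i * zshift i (Poly_Mapping.lookup b j)))"

lemma skew_times_superset:
  assumes "finite I" "finite J" "Poly_Mapping.keys a \<subseteq> I" "Poly_Mapping.keys b \<subseteq> J"
  shows "skew_times a b = (\<Sum>i\<in>I. \<Sum>j\<in>J.
     Poly_Mapping.single (i + j) (Poly_Mapping.lookup a i * zshift i (Poly_Mapping.lookup b j)))"
proof -
  have "skew_times a b = (\<Sum>i\<in>Poly_Mapping.keys a. \<Sum>j\<in>J.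
     Poly_Mapping.single (i + j) (Poly_Mapping.lookup a i * zshift i (Poly_Mapping.lookup b j)))"
    unfolding skew_times_def
    by (intro sum.cong refl sum.mono_neutral_left) (use assms in \<open>auto simp: in_keys_iff\<close>)
  also have "\<dots> = (\<Sum>i\<in>I. \<Sum>j\<in>J.
     Poly_Mapping.single (i + j) (Poly_Mapping.lookup a i * zshift i (Poly_Mapping.lookup b j)))"
    by (intro sum.mono_neutral_left) (use assms in \<open>auto simp: in_keys_iff\<close>)
  finally show ?thesis .
qed

lemma skew_times_add_left: "skew_times (a + b) c = skew_times a c + skew_times b c"
proof -
  let ?I = "Poly_Mapping.keys a \<union> Poly_Mapping.keys b" and ?J = "Poly_Mapping.keys c"
  have "Poly_Mapping.keys (a + b) \<subseteq> ?I" by (rule keys_add)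
  thus ?thesis
    by (subst (1 2 3) skew_times_superset[of ?I ?J])
       (auto simp: lookup_add algebra_simps single_add sum.distrib)
qed

lemma skew_times_add_right: "skew_times c (a + b) = skew_times c a + skew_times c b"
proof -
  let ?I = "Poly_Mapping.keys a \<union> Poly_Mapping.keys b" and ?J = "Poly_Mapping.keys c"
  have "Poly_Mapping.keys (a + b) \<subseteq> ?I" by (rule keys_add)
  thus ?thesis
    by (subst (1 2 3) skew_times_superset[of ?J ?I])
       (auto simp: lookup_add algebra_simps single_add sum.distrib zshift_add)
qed

lemma skew_times_zero [simp]: "skew_times 0 a = 0" "skew_times a 0 = 0"
  by (simp_all add: skew_times_def)

lemma skew_times_single [simp]:
  "skew_times (Poly_Mapping.single i f) (Poly_Mapping.single j g)
     = Poly_Mapping.single (i + j) (f * zshift i g)"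
  by (subst skew_times_superset[of "{i}" "{j}"]) (auto split: if_splits)

lemma poly_mapping_single_induct [case_names zero add]:
  fixes a :: "'i \<Rightarrow>\<^sub>0 'c::comm_monoid_add"
  assumes "P 0" and "\<And>i c a. P a \<Longrightarrow> P (Poly_Mapping.single i c + a)"
  shows "P a"
proof -
  have "P (\<Sum>i\<in>I. Poly_Mapping.single i (Poly_Mapping.lookup a i))" if "finite I" for I
    using that by (induction I rule: finite_induct) (auto intro: assms)
  moreover have "a = (\<Sum>i\<in>Poly_Mapping.keys a. Poly_Mapping.single i (Poly_Mapping.lookup a i))"
    by (rule poly_mapping_eqI)
       (simp add: lookup_sum lookup_single when_def sum.delta in_keys_iff)
  ultimately show ?thesis by (metis finite_keys)
qed

lemma skew_times_assoc: "skew_times (skew_times a b) c = skew_times a (skew_times b c)"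
proof (induction a rule: poly_mapping_single_induct)
  case (add i f a)
  have "skew_times (skew_times (Poly_Mapping.single i f) b) c
      = skew_times (Poly_Mapping.single i f) (skew_times b c)"
  proof (induction b rule: poly_mapping_single_induct)
    case (add j g b)
    have "skew_times (skew_times (Poly_Mapping.single i f) (Poly_Mapping.single j g)) c
        = skew_times (Poly_Mapping.single i f) (skew_times (Poly_Mapping.single j g) c)"
      by (induction c rule: poly_mapping_single_induct)
         (simp_all add: skew_times_add_right add_ac mult_ac zshift_mult zshift_zshift)
    with add show ?case by (simp add: skew_times_add_left skew_times_add_right)
  qed simp
  with add show ?case by (simp add: skew_times_add_left)
qed simp

lemma skew_times_one:
  "skew_times (Poly_Mapping.single 0 1) a = a" "skew_times a (Poly_Mapping.single 0 1) = a"
  by (induction a rule: poly_mapping_single_induct)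
     (simp_all add: skew_times_add_right skew_times_add_left del: single_one)

typedef (overloaded) 'k qgr = "UNIV :: (int \<Rightarrow>\<^sub>0 'k::field poly fract) set"
  by simp

lemma Rep_Abs_qgr [simp]: "Rep_qgr (Abs_qgr a) = a"
  by (simp add: Abs_qgr_inverse)

instantiation qgr :: (field) ring_1
begin
definition "0 = Abs_qgr 0"
definition "1 = Abs_qgr (Poly_Mapping.single 0 1)"
definition "a + b = Abs_qgr (Rep_qgr a + Rep_qgr b)"
definition "a - b = Abs_qgr (Rep_qgr a - Rep_qgr b)"
definition "- a = Abs_qgr (- Rep_qgr a)"
definition "a * b = Abs_qgr (skew_times (Rep_qgr a) (Rep_qgr b))"
instance
proof
  have "(Poly_Mapping.single 0 1 :: int \<Rightarrow>\<^sub>0 'a poly fract) \<noteq> 0"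
    by (metis lookup_single_eq lookup_zero zero_neq_one)
  thus "(0 :: 'a qgr) \<noteq> 1"
    by (simp add: zero_qgr_def one_qgr_def Abs_qgr_inject)
qed (simp_all add: zero_qgr_def one_qgr_def plus_qgr_def minus_qgr_def uminus_qgr_def
       times_qgr_def Rep_qgr_inverse algebra_simps skew_times_assoc skew_times_one
       skew_times_add_left skew_times_add_right del: single_one)
end

text \<open>\<open>qmono f i\<close> is \<open>f x\<^sup>i\<close>.\<close>

definition qmono :: "'k::field poly fract \<Rightarrow> int \<Rightarrow> 'k qgr" where
  "qmono f i = Abs_qgr (Poly_Mapping.single i f)"

lemma qmono_mult: "qmono f i * qmono g j = qmono (f * zshift i g) (i + j)"
  by (simp add: qmono_def times_qgr_def)

lemma qmono_add: "qmono f i + qmono g i = qmono (f + g) i"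
  by (simp add: qmono_def plus_qgr_def single_add)

lemma qmono_0_1: "qmono 1 0 = 1"
  by (simp add: qmono_def one_qgr_def del: single_one)

definition qcoef :: "'k::field poly \<Rightarrow> 'k qgr" where
  "qcoef p = qmono (to_fract p) 0"

definition q_comp :: "int \<Rightarrow> 'k::field qgr set" where
  "q_comp i = range (\<lambda>f. qmono f i)"

text \<open>The inclusion of \<open>A\<close> into its graded quotient ring: \<open>x\<close> and \<open>z\<close> go to themselves, and
  \<open>x y = z\<^sup>2\<close> forces \<open>y = x\<^sup>-\<^sup>1 z\<^sup>2\<close>.\<close>

fun qgen :: "gen \<Rightarrow> 'k::field qgr" where
  "qgen GX = qmono 1 1"
| "qgen GY = qmono 1 (- 1) * qcoef [:0, 1:] ^ 2"
| "qgen GZ = qcoef [:0, 1:]"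

definition q_eval :: "'k::field free_alg \<Rightarrow> 'k qgr" where
  "q_eval p = (\<Sum>w\<in>Poly_Mapping.keys p.
     qcoef [:Poly_Mapping.lookup p w:] * (\<Prod>g\<leftarrow>w. qgen g))"

definition A_emb :: "'k::field free_alg set \<Rightarrow> 'k qgr" where
  "A_emb C = the_elem (q_eval ` C)"

lemma qcoef_add: "qcoef p + qcoef q = qcoef (p + q)"
  by (simp add: qcoef_def qmono_add to_fract_def)

lemma qcoef_0 [simp]: "qcoef 0 = 0"
  using qcoef_add[of 0 0] by simp

lemma qcoef_mult: "qcoef p * qcoef q = qcoef (p * q)"
  by (simp add: qcoef_def qmono_mult to_fract_def)

lemma qcoef_1 [simp]: "qcoef 1 = 1"
  by (simp add: qcoef_def to_fract_def qmono_0_1 One_fract_def[symmetric])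

lemma qcoef_const_comm: "qcoef [:c:] * a = a * qcoef [:c:]"
proof -
  have "skew_times (Poly_Mapping.single 0 (to_fract [:c:])) b
      = skew_times b (Poly_Mapping.single 0 (to_fract [:c:]))" for b
    by (induction b rule: poly_mapping_single_induct)
       (simp_all add: skew_times_add_left skew_times_add_right to_fract_def zshift_Fract pcompose_1 mult.commute)
  thus ?thesis by (simp add: qcoef_def qmono_def times_qgr_def)
qed

lemma q_eval_superset:
  assumes "finite I" "Poly_Mapping.keys p \<subseteq> I"
  shows "q_eval p = (\<Sum>w\<in>I. qcoef [:Poly_Mapping.lookup p w:] * (\<Prod>g\<leftarrow>w. qgen g))"
  unfolding q_eval_def
proof (intro sum.mono_neutral_left ballI)
  fix w assume "w \<in> I - Poly_Mapping.keys p"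
  thus "qcoef [:Poly_Mapping.lookup p w:] * (\<Prod>g\<leftarrow>w. qgen g) = 0"
    by (simp add: in_keys_iff)
qed (use assms in auto)

lemma q_eval_add: "q_eval (p + q) = q_eval p + q_eval q"
proof -
  have "Poly_Mapping.keys (p + q) \<subseteq> Poly_Mapping.keys p \<union> Poly_Mapping.keys q"
    by (rule keys_add)
  thus ?thesis
    by (subst (1 2 3) q_eval_superset[of "Poly_Mapping.keys p \<union> Poly_Mapping.keys q"])
       (auto simp: lookup_add qcoef_add simp flip: sum.distrib distrib_right)
qed

lemma q_eval_zero [simp]: "q_eval 0 = 0"
  by (simp add: q_eval_def)

lemma q_eval_single: "q_eval (Poly_Mapping.single w c) = qcoef [:c:] * (\<Prod>g\<leftarrow>w. qgen g)"
  by (subst q_eval_superset[of "{w}"]) (auto split: if_splits)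

lemma q_eval_one [simp]: "q_eval 1 = 1"
  unfolding single_one[symmetric] q_eval_single by (simp add: zero_list_def one_pCons[symmetric])

lemma q_eval_mult: "q_eval (p * q) = q_eval p * q_eval q"
proof (induction p rule: poly_mapping_single_induct)
  case (add v c p)
  have "q_eval (Poly_Mapping.single v c * q) = q_eval (Poly_Mapping.single v c) * q_eval q"
  proof (induction q rule: poly_mapping_single_induct)
    case (add w d q)
    have swap: "qcoef [:d:] * (a * b) = a * (qcoef [:d:] * b)" for a b :: "'a qgr"
      using qcoef_const_comm[of d a] by (simp flip: mult.assoc)
    have "q_eval (Poly_Mapping.single v c * Poly_Mapping.single w d)
        = qcoef [:c:] * qcoef [:d:] * ((\<Prod>g\<leftarrow>v. qgen g) * (\<Prod>g\<leftarrow>w. qgen g))"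
      by (simp add: mult_single q_eval_single plus_list_def qcoef_mult mult.commute[of d c])
    also have "\<dots> = q_eval (Poly_Mapping.single v c) * q_eval (Poly_Mapping.single w d)"
      by (simp only: q_eval_single mult.assoc swap)
    finally show ?case using add by (simp add: distrib_left q_eval_add)
  qed simp
  thus ?case using add by (simp add: distrib_right q_eval_add)
qed simp

lemma q_eval_fgen [simp]: "q_eval (fgen g) = qgen g"
  by (simp add: fgen_def q_eval_single one_pCons[symmetric])

lemma zshift_to_fract: "zshift i (to_fract p) = to_fract (pcompose p [:of_int i, 1:])"
  by (simp add: to_fract_def zshift_Fract pcompose_1)

lemma qgen_rels:
  defines "x \<equiv> qgen GX" and "y \<equiv> qgen GY" and "z \<equiv> qgen GZ"
  shows "x * z = (z + 1) * x" "y * z = (z - 1) * y" "x * y = z ^ 2" "y * x = (z - 1) ^ 2"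
proof -
  have "[:0, 1:] + [:1:] = [:1, 1 :: 'a:]" "[:- 1, 1:] + [:1:] = [:0, 1 :: 'a:]" by simp_all
  moreover have "qcoef [:1 :: 'a:] = 1" by (simp add: one_pCons[symmetric])
  ultimately have z1: "z + 1 = qcoef [:1, 1:]" and z2: "z - 1 = qcoef [:- 1, 1:]"
    using qcoef_add[of "[:0, 1 :: 'a:]" "[:1:]"] qcoef_add[of "[:- 1, 1 :: 'a:]" "[:1:]"]
    unfolding z_def qgen.simps by (simp_all only: diff_eq_eq)
  show "x * z = (z + 1) * x" "y * z = (z - 1) * y" "x * y = z ^ 2" "y * x = (z - 1) ^ 2"
    unfolding z1 z2
    by (simp_all add: x_def y_def z_def qcoef_def power2_eq_square qmono_mult zshift_to_fract
          zshift_mult pcompose_pCons mult_ac)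
qed

lemma A_emb_class: "A_emb (A_class p) = q_eval p"
proof -
  interpret F: ring "univ_ring :: 'a free_alg ring" by (rule ring_univ_ring)
  have minus: "q_eval (p - q) = q_eval p - q_eval q" for p q :: "'a free_alg"
    using q_eval_add[of "p - q" q] by (simp add: algebra_simps)
  have "ideal {p. q_eval p = (0 :: 'a qgr)} univ_ring"
  proof (rule idealI[OF ring_univ_ring])
    show "subgroup {p. q_eval p = (0 :: 'a qgr)} (add_monoid univ_ring)"
    proof (rule F.add.subgroupI)
      fix p :: "'a free_alg" assume "p \<in> {p. q_eval p = 0}"
      moreover have "\<ominus>\<^bsub>univ_ring\<^esub> p = - p"
        by (rule F.minus_equality) simp_all
      ultimately show "\<ominus>\<^bsub>univ_ring\<^esub> p \<in> {p. q_eval p = 0}"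
        using minus[of 0 p] by simp
    qed (auto simp: q_eval_add intro: exI[of _ 0])
  qed (simp_all add: q_eval_mult)
  moreover have "A_rels \<subseteq> {p. q_eval p = (0 :: 'a qgr)}"
    unfolding A_rels_def Let_def
    by (auto simp: minus q_eval_add q_eval_mult qgen_rels power2_eq_square simp del: qgen.simps)
  ultimately have "genideal univ_ring A_rels \<subseteq> {p. q_eval p = (0 :: 'a qgr)}"
    by (rule F.genideal_minimal)
  moreover have "(0 :: 'a free_alg) \<in> genideal univ_ring A_rels"
    using additive_subgroup.zero_closed[OF ideal.axioms(1)[OF F.genideal_ideal[of A_rels]]] by simp
  ultimately have "q_eval ` A_class p = {q_eval p}"
    by (force simp: presented_class_def a_r_coset_def r_coset_def q_eval_add)
  thus ?thesis by (simp add: A_emb_def)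
qed


section \<open>Graded right \<open>A\<close>-modules\<close>

record ('a, 'm) grmod =
  mcarrier :: "'m set"
  mcomp :: "int \<Rightarrow> 'm set"
  madd :: "'m \<Rightarrow> 'm \<Rightarrow> 'm"
  mzero :: 'm
  mact :: "'m \<Rightarrow> 'a \<Rightarrow> 'm"

definition gr_hom ::
  "('k::field free_alg set, 'm) grmod \<Rightarrow> ('k free_alg set, 'n) grmod \<Rightarrow> ('m \<Rightarrow> 'n) set" where
  "gr_hom M N = {f \<in> mcarrier M \<rightarrow>\<^sub>E mcarrier N.
     (\<forall>m\<in>mcarrier M. \<forall>m'\<in>mcarrier M. f (madd M m m') = madd N (f m) (f m')) \<and>
     (\<forall>m\<in>mcarrier M. \<forall>a\<in>carrier algA. f (mact M m a) = mact N (f m) a) \<and>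
     (\<forall>i. f ` mcomp M i \<subseteq> mcomp N i)}"

definition gr_epi ::
  "('k::field free_alg set, 'm) grmod \<Rightarrow> ('k free_alg set, 'n) grmod \<Rightarrow> ('m \<Rightarrow> 'n) set" where
  "gr_epi M N = {f \<in> gr_hom M N. f ` mcarrier M = mcarrier N}"

definition gr_ker :: "('a, 'm) grmod \<Rightarrow> ('a, 'n) grmod \<Rightarrow> ('m \<Rightarrow> 'n) \<Rightarrow> 'm set" where
  "gr_ker M N f = {m \<in> mcarrier M. f m = mzero N}"

definition gr_shift :: "('a, 'm) grmod \<Rightarrow> int \<Rightarrow> ('a, 'm) grmod" where
  "gr_shift M n = M\<lparr>mcomp := \<lambda>i. mcomp M (i - n)\<rparr>"

definition right_ideal_gen :: "'k::field free_alg set set \<Rightarrow> 'k free_alg set set" where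
  "right_ideal_gen S = \<Inter>{I. additive_subgroup I algA \<and> S \<subseteq> I \<and>
     (\<forall>a\<in>I. \<forall>r\<in>carrier algA. a \<otimes>\<^bsub>algA\<^esub> r \<in> I)}"

definition A_mod ::
  "'k::field free_alg set set \<Rightarrow> ('k free_alg set, 'k free_alg set set) grmod" where
  "A_mod S = (let I = right_ideal_gen S in
     \<lparr>mcarrier = a_rcosets\<^bsub>algA\<^esub> I,
      mcomp = \<lambda>i. (\<lambda>a. I +>\<^bsub>algA\<^esub> a) ` A_comp i,
      madd = (\<lambda>C D. C <+>\<^bsub>algA\<^esub> D),
      mzero = I,
      mact = \<lambda>C a. \<Union>c\<in>C. I +>\<^bsub>algA\<^esub> (c \<otimes>\<^bsub>algA\<^esub> a)\<rparr>)"

definition modX :: "('k::field free_alg set, 'k free_alg set set) grmod" where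
  "modX = A_mod {A_class (fgen GX), A_class (fgen GZ)}"

definition modY :: "('k::field free_alg set, 'k free_alg set set) grmod" where
  "modY = gr_shift (A_mod {A_class (fgen GY), A_class (fgen GZ - 1)}) 1"

text \<open>A graded submodule of the quotient ring, in particular a rank one graded projective, is
  given by its underlying set.\<close>

definition q_mod :: "'k::field qgr set \<Rightarrow> ('k free_alg set, 'k qgr) grmod" where
  "q_mod P = \<lparr>mcarrier = P, mcomp = \<lambda>i. P \<inter> q_comp i, madd = (+), mzero = 0,
     mact = \<lambda>q a. q * A_emb a\<rparr>"

definition A_sub :: "'k::field qgr set" where
  "A_sub = A_emb ` carrier algA"


section \<open>The functors \<open>\<iota>\<^sub>J\<close> on rank one graded projectives\<close>

text \<open>The kernel does not depend on the choice of the epimorphism: in each degree it is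
  prescribed by its colength and by the annihilator of \<open>A/xA\<close> resp. \<open>A/yA\<close> in \<open>k[z]\<close>.\<close>

definition iota :: "int \<Rightarrow> 'k::field qgr set \<Rightarrow> 'k qgr set" where
  "iota n P =
    (if gr_epi (q_mod P) (gr_shift modX n) \<noteq> {} then
       let N = gr_shift (A_mod {A_class (fgen GX)}) n in
         THE K. \<exists>f\<in>gr_epi (q_mod P) N. K = gr_ker (q_mod P) N f
     else if gr_epi (q_mod P) (gr_shift modY n) \<noteq> {} then
       let N = gr_shift (A_mod {A_class (fgen GY)}) (n + 1) in
         THE K. \<exists>f\<in>gr_epi (q_mod P) N. K = gr_ker (q_mod P) N f
     else undefined)"

text \<open>\<open>\<int>\<^sub>f\<^sub>i\<^sub>n\<close> is \<^typ>\<open>int fset\<close> with symmetric difference as addition.\<close>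

definition zfin_add :: "int fset \<Rightarrow> int fset \<Rightarrow> int fset" (infixl \<open>\<oplus>\<^sub>Z\<close> 65) where
  "I \<oplus>\<^sub>Z J = (I |-| J) |\<union>| (J |-| I)"

text \<open>The \<open>\<iota>\<^sub>n\<close> commute, so the order in which they are composed is immaterial; the
  definition uses the increasing enumeration of \<open>J\<close>.\<close>

definition iota_fset :: "int fset \<Rightarrow> 'k::field qgr set \<Rightarrow> 'k qgr set" where
  "iota_fset J = foldr iota (sorted_list_of_fset J)"

text \<open>The value of \<open>\<iota>\<^sub>J\<close> at a morphism \<open>f\<close> with domain \<open>P\<close>.\<close>

definition iota_hom ::
  "int fset \<Rightarrow> 'k::field qgr set \<Rightarrow> ('k qgr \<Rightarrow> 'k qgr) \<Rightarrow> 'k qgr \<Rightarrow> 'k qgr" where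
  "iota_hom J P f = restrict f (iota_fset J P)"

definition hpoly :: "int fset \<Rightarrow> 'k::field poly" where
  "hpoly J = (\<Prod>j\<in>fset J. [:of_int j, 1:] ^ 2)"

definition sigma_hom :: "int fset \<Rightarrow> 'k::field qgr \<Rightarrow> 'k qgr" where
  "sigma_hom J = restrict (\<lambda>q. qmono (inverse (to_fract (hpoly J))) 0 * q)
     (iota_fset J (iota_fset J A_sub))"


section \<open>The ring \<open>B\<close>\<close>

definition B_hom :: "int fset \<Rightarrow> ('k::field qgr \<Rightarrow> 'k qgr) set" where
  "B_hom J = gr_hom (q_mod A_sub) (q_mod (iota_fset J A_sub))"

text \<open>\<open>B_times I J a b = \<iota>\<^bsub>I \<oplus> J\<^esub>(\<sigma>\<^bsub>I \<inter> J\<^esub>) \<circ> \<iota>\<^sub>J(a) \<circ> b\<close> for \<open>a \<in> B\<^sub>I\<close>, \<open>b \<in> B\<^sub>J\<close>.\<close>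

definition B_times ::
  "int fset \<Rightarrow> int fset \<Rightarrow> ('k::field qgr \<Rightarrow> 'k qgr) \<Rightarrow> ('k qgr \<Rightarrow> 'k qgr) \<Rightarrow> 'k qgr \<Rightarrow> 'k qgr" where
  "B_times I J a b =
    (let K = I |\<inter>| J in
     compose A_sub (iota_hom (I \<oplus>\<^sub>Z J) (iota_fset K (iota_fset K A_sub)) (sigma_hom K))
       (compose A_sub (iota_hom J A_sub a) b))"

definition B_zero_hom :: "'k::field qgr \<Rightarrow> 'k qgr" where
  "B_zero_hom = restrict (\<lambda>_. 0) A_sub"

definition B_support :: "(int fset \<Rightarrow> 'k::field qgr \<Rightarrow> 'k qgr) \<Rightarrow> int fset set" where
  "B_support F = {J. F J \<noteq> B_zero_hom}"

definition B_incl ::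
  "int fset \<Rightarrow> ('k::field qgr \<Rightarrow> 'k qgr) \<Rightarrow> int fset \<Rightarrow> 'k qgr \<Rightarrow> 'k qgr" where
  "B_incl J f = (\<lambda>_. B_zero_hom)(J := f)"

definition ringB :: "(int fset \<Rightarrow> 'k::field qgr \<Rightarrow> 'k qgr) ring" where
  "ringB =
    \<lparr>carrier = {F. (\<forall>J. F J \<in> B_hom J) \<and> finite (B_support F)},
     mult = \<lambda>F G K. restrict (\<lambda>q.
       \<Sum>(I, J)\<in>{(I, J). I \<in> B_support F \<and> J \<in> B_support G \<and> I \<oplus>\<^sub>Z J = K}.
         B_times I J (F I) (G J) q) A_sub,
     one = B_incl {||} (restrict (\<lambda>q. q) A_sub),
     zero = \<lambda>_. B_zero_hom,
     add = \<lambda>F G J. restrict (\<lambda>q. F J q + G J q) A_sub\<rparr>"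

definition B_comp :: "int fset \<Rightarrow> (int fset \<Rightarrow> 'k::field qgr \<Rightarrow> 'k qgr) set" where
  "B_comp J = B_incl J ` B_hom J"

definition left_mult :: "'k::field poly \<Rightarrow> 'k qgr \<Rightarrow> 'k qgr" where
  "left_mult p = restrict (\<lambda>q. qcoef p * q) A_sub"


section \<open>The presentation\<close>

text \<open>\<open>k[z][b\<^sub>n | n \<in> \<int>]\<close>, with exponent vectors \<^typ>\<open>int \<Rightarrow>\<^sub>0 nat\<close>.\<close>

type_synonym 'k bpoly = "(int \<Rightarrow>\<^sub>0 nat) \<Rightarrow>\<^sub>0 'k poly"

definition bvar :: "int \<Rightarrow> 'k::field bpoly" where
  "bvar n = Poly_Mapping.single (Poly_Mapping.single n 1) 1"

definition bconst :: "'k::field poly \<Rightarrow> 'k bpoly" where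
  "bconst p = Poly_Mapping.single 0 p"

definition B_rels :: "'k::field bpoly set" where
  "B_rels = {bvar n ^ 2 - bconst ([:of_int n, 1:] ^ 2) | n. True}"

text \<open>The degree of \<open>\<Prod> b\<^sub>n\<^bsup>m\<^sub>n\<^esup>\<close> is the sum over \<open>n\<close> of \<open>m\<^sub>n\<close> copies of \<open>{n}\<close> in
  \<open>\<int>\<^sub>f\<^sub>i\<^sub>n\<close>, which contains \<open>n\<close> iff \<open>m\<^sub>n\<close> is odd.\<close>

definition pres_comp :: "int fset \<Rightarrow> 'k::field bpoly set set" where
  "pres_comp J = presented_class B_rels `
     {p. \<forall>m\<in>Poly_Mapping.keys p. {n. odd (Poly_Mapping.lookup m n)} = fset J}"

end

theory Submission
  imports Defs
begin

text \<open>
  Every module involved is a graded lattice \<open>\<Oplus> p\<^sub>i k[z] x\<^sup>i\<close> inside \<open>k(z)[x\<^sup>\<plusminus>\<^sup>1; \<sigma>]\<close>. Such a lattice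
  is stable under right multiplication by \<open>x\<close>, \<open>y\<close> and \<open>z\<close> iff \<open>p\<^sub>i\<close> is a multiple of \<open>p\<^sub>i\<^sub>+\<^sub>1\<close> and
  divides \<open>p\<^sub>i\<^sub>+\<^sub>1 (z + i)\<^sup>2\<close>. For the lattices that occur, \<open>p\<^sub>i / p\<^sub>i\<^sub>+\<^sub>1\<close> is either \<open>1\<close> or
  \<open>(z + i)\<^sup>2\<close>, so up to a common factor a lattice is recorded by its type
  \<open>T = {i. p\<^sub>i = p\<^sub>i\<^sub>+\<^sub>1}\<close>; the type of \<open>A\<close> is the set of nonnegative integers.

  The lattice surjects onto \<open>X\<langle>n\<rangle>\<close> if \<open>n \<in> T\<close> and onto \<open>Y\<langle>n\<rangle>\<close> if \<open>n \<notin> T\<close>. Any graded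
  epimorphism from a lattice onto a quotient of lattices \<open>\<Oplus> a\<^sub>i k[z] x\<^sup>i / \<Oplus> a\<^sub>i e\<^sub>i k[z] x\<^sup>i\<close> is in
  each degree multiplication by a polynomial invertible modulo \<open>e\<^sub>i\<close>, so that its kernel is
  \<open>\<Oplus> p\<^sub>i e\<^sub>i k[z] x\<^sup>i\<close> whatever the epimorphism (\<open>epi_kernel\<close>). Consequently \<open>\<iota>\<^sub>n\<close> toggles the
  membership of \<open>n\<close> in the type, and multiplies the common factor by \<open>(z + n)\<^sup>2\<close> if \<open>n\<close> enters it
  (\<open>iota_lat\<close>). To regard \<open>A/xA\<close> and the other modules as quotients of lattices one has to know
  that \<open>A\<close> embeds into its graded quotient ring; this follows from the normal form
  \<open>\<Sum> u\<^sub>i(z) x\<^sup>i + \<Sum> v\<^sub>i(z) y\<^sup>i\<close> of the elements of \<open>A\<close> (\<open>q_eval_eq_iff\<close>).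

  The degree zero part of \<open>\<iota>\<^sub>J A\<close> is therefore \<open>h\<^sub>J k[z]\<close>, and \<open>B\<^sub>J\<close> consists of the left
  multiplications by elements of \<open>h\<^sub>J k[z]\<close> (\<open>B_hom_eq\<close>); the product of the multiplications by
  \<open>f \<in> h\<^sub>I k[z]\<close> and \<open>g \<in> h\<^sub>J k[z]\<close> is the multiplication by \<open>f g / h\<^bsub>I \<inter> J\<^esub>\<close>
  (\<open>B_times_left_mult\<close>). With \<open>s\<^sub>J = \<Prod>\<^bsub>j \<in> J\<^esub> (z + j)\<close>, a square root of \<open>h\<^sub>J\<close>, one has
  \<open>s\<^sub>I s\<^sub>J = h\<^bsub>I \<inter> J\<^esub> s\<^bsub>I \<oplus> J\<^esub>\<close>, so dividing the component of degree \<open>J\<close> by \<open>s\<^sub>J\<close> turns this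
  product into that of the group ring \<open>k[z][\<int>\<^sub>f\<^sub>i\<^sub>n]\<close>. Thus \<open>B\<close> is the subring of
  the group ring generated over \<open>k[z]\<close> by the \<open>b\<^sub>n = (z + n) t\<^sub>n\<close>, where \<open>t\<^sub>n\<^sup>2 = 1\<close>; this
  makes \<open>B\<close> a ring. The relations \<open>b\<^sub>n\<^sup>2 = (z + n)\<^sup>2\<close> hold in it, and they reduce every
  element of the presented ring to a combination of squarefree monomials, one for each \<open>J\<close>,
  which have independent images (\<open>to_group_ring_kernel\<close>).
\<close>

section \<open>Graded lattices in the graded quotient ring\<close>

definition qlook :: "'k::field qgr \<Rightarrow> int \<Rightarrow> 'k poly fract" where
  "qlook q i = Poly_Mapping.lookup (Rep_qgr q) i"

lemma qgr_eqI: "(\<And>i. qlook p i = qlook q i) \<Longrightarrow> p = q"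
  by (metis Rep_qgr_inject poly_mapping_eqI qlook_def)

lemma finite_qlook: "finite {i. qlook q i \<noteq> 0}"
  by (simp add: qlook_def)

lemma qlook_simps [simp]:
  "qlook 0 i = 0" "qlook (p + q) i = qlook p i + qlook q i" "qlook (p - q) i = qlook p i - qlook q i"
  "qlook (- p) i = - qlook p i" "qlook (qmono f j) i = (if i = j then f else 0)"
  by (auto simp: qlook_def zero_qgr_def plus_qgr_def minus_qgr_def uminus_qgr_def qmono_def
      lookup_add lookup_minus lookup_single when_def)

lemma qlook_sum: "qlook (sum f A) i = (\<Sum>a\<in>A. qlook (f a) i)"
  by (induction A rule: infinite_finite_induct) auto

lemma qgr_expand: "q = (\<Sum>i | qlook q i \<noteq> 0. qmono (qlook q i) i)"
proof (rule qgr_eqI)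
  fix i
  have "(\<Sum>x | qlook q x \<noteq> 0. if i = x then qlook q x else 0) = qlook q i"
    by (simp add: finite_qlook)
  then show "qlook q i = qlook (\<Sum>i | qlook q i \<noteq> 0. qmono (qlook q i) i) i"
    by (simp add: qlook_sum)
qed

lemma qmono_zero [simp]: "qmono 0 i = 0"
  by (rule qgr_eqI) simp

lemma qgr_induct [case_names zero add]:
  assumes "P 0" and "\<And>f i q. P q \<Longrightarrow> P (qmono f i + q)"
  shows "P q"
proof -
  have "P (\<Sum>i\<in>I. qmono (qlook q i) i)" if "finite I" for I
    using that by (induction I rule: finite_induct) (auto intro: assms)
  then show ?thesis using qgr_expand[of q] finite_qlook[of q] by metis
qed

lemma qlook_mono_mult: "qlook (qmono f i * q) j = f * zshift i (qlook q (j - i))"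
  by (induction q rule: qgr_induct) (auto simp: distrib_left qmono_mult zshift_add algebra_simps)

lemma qlook_mult_mono: "qlook (q * qmono f i) j = qlook q (j - i) * zshift (j - i) f"
  by (induction q rule: qgr_induct) (auto simp: distrib_right qmono_mult algebra_simps)

lemma qlook_coef_mult [simp]: "qlook (qcoef u * q) j = to_fract u * qlook q j"
  by (simp add: qcoef_def qlook_mono_mult)

lemma qlook_coef [simp]: "qlook (qcoef u) j = (if j = 0 then to_fract u else 0)"
  by (simp add: qcoef_def)

lemma qlook_one [simp]: "qlook 1 i = (if i = 0 then 1 else 0)"
  by (simp flip: qmono_0_1)

lemma qlook_mult_coef: "qlook (q * qcoef u) j = qlook q j * to_fract (pcompose u [:of_int j, 1:])"
  by (simp add: qcoef_def qlook_mult_mono zshift_to_fract)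

lemma q_comp_iff: "q \<in> q_comp i \<longleftrightarrow> (\<forall>j. j \<noteq> i \<longrightarrow> qlook q j = 0)"
proof
  assume *: "\<forall>j. j \<noteq> i \<longrightarrow> qlook q j = 0"
  have "q = qmono (qlook q i) i"
    by (rule qgr_eqI) (use * in simp)
  then show "q \<in> q_comp i" by (metis q_comp_def rangeI)
qed (auto simp: q_comp_def)

text \<open>The lattice \<open>\<Oplus> p\<^sub>i k[z] x\<^sup>i\<close>.\<close>

definition glat :: "(int \<Rightarrow> 'k::field poly) \<Rightarrow> 'k qgr set" where
  "glat p = {q. \<forall>i. \<exists>u. qlook q i = to_fract (p i * u)}"

lemma glat_zero [simp]: "0 \<in> glat p"
  by (auto simp: glat_def intro: exI[of _ 0])

lemma glatE:
  assumes "q \<in> glat p"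
  obtains u where "\<forall>i. qlook q i = to_fract (p i * u i)"
  using assms unfolding glat_def by (auto dest!: choice simp del: to_fract_mult)

lemma glatI: "(\<And>i. qlook q i = to_fract (p i * u i)) \<Longrightarrow> q \<in> glat p"
  by (auto simp: glat_def simp del: to_fract_mult)

lemma glat_add:
  assumes "q \<in> glat p" "r \<in> glat p"
  shows "q + r \<in> glat p"
proof -
  from assms obtain u v where "\<forall>i. qlook q i = to_fract (p i * u i)"
    "\<forall>i. qlook r i = to_fract (p i * v i)" by (auto elim!: glatE simp del: to_fract_mult)
  then show ?thesis by (intro glatI[where u = "\<lambda>i. u i + v i"]) (simp add: distrib_left)
qed

lemma glat_uminus:
  assumes "q \<in> glat p"
  shows "- q \<in> glat p"
proof -
  from assms obtain u where "\<forall>i. qlook q i = to_fract (p i * u i)"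
    by (auto elim!: glatE simp del: to_fract_mult)
  then show ?thesis by (intro glatI[where u = "\<lambda>i. - u i"]) simp
qed

lemma glat_diff: "q \<in> glat p \<Longrightarrow> r \<in> glat p \<Longrightarrow> q - r \<in> glat p"
  using glat_add[of q p "- r"] glat_uminus by fastforce

lemma glat_sum: "(\<And>i. i \<in> A \<Longrightarrow> f i \<in> glat p) \<Longrightarrow> sum f A \<in> glat p"
  by (induction A rule: infinite_finite_induct) (auto intro: glat_add)

lemma glat_mono:
  assumes "\<And>i. p i dvd r i"
  shows "glat r \<subseteq> glat p"
proof
  fix q assume "q \<in> glat r"
  then obtain u where u: "\<forall>i. qlook q i = to_fract (r i * u i)" by (rule glatE)
  obtain w where "\<And>i. r i = p i * w i" using assms unfolding dvd_def by metis
  then show "q \<in> glat p"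
    by (intro glatI[where u = "\<lambda>i. w i * u i"]) (simp add: u mult.assoc)
qed

lemma qmono_in_glat: "qmono (to_fract u) i \<in> glat p \<longleftrightarrow> p i dvd u"
  by (auto simp: glat_def dvd_def simp del: to_fract_mult intro: exI[of _ 0])

lemma qcoef_in_glat: "qcoef u \<in> glat p \<longleftrightarrow> p 0 dvd u"
  by (simp add: qcoef_def qmono_in_glat)

definition lin :: "int \<Rightarrow> 'k::field poly" where
  "lin j = [:of_int j, 1:]"

lemma lin_nonzero [simp]: "lin j \<noteq> 0"
  by (simp add: lin_def)

lemma lin_shift: "pcompose (lin j) [:of_int i, 1:] = lin (i + j)"
  by (simp add: lin_def pcompose_pCons)

lemma qgen_Y: "qgen GY = qmono (to_fract (lin (- 1) ^ 2)) (- 1)"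
  by (simp add: qcoef_def power2_eq_square qmono_mult zshift_to_fract zshift_mult lin_def
       pcompose_pCons pcompose_1 one_pCons[symmetric] del: mult_pCons_left mult_pCons_right)

lemma qgen_Z: "qgen GZ = qcoef (lin 0)"
  by (simp add: lin_def)

text \<open>The two divisibilities express stability of \<open>glat p\<close> under right multiplication by \<open>x\<close> and
  by \<open>y\<close>: since \<open>x\<^sup>i y = (z + i - 1)\<^sup>2 x\<^sup>i\<^sup>-\<^sup>1\<close>, the product of the degree \<open>i + 1\<close> component with
  \<open>y\<close> is generated by \<open>p\<^sub>i\<^sub>+\<^sub>1 (z + i)\<^sup>2\<close>.\<close>

definition A_stable :: "(int \<Rightarrow> 'k::field poly) \<Rightarrow> bool" where
  "A_stable p \<longleftrightarrow> (\<forall>i. p (i + 1) dvd p i \<and> p i dvd p (i + 1) * lin i ^ 2)"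

lemma A_stableD:
  assumes "A_stable p"
  shows "p j dvd p (j - 1)" "p j dvd p (j + 1) * lin j ^ 2"
  using assms unfolding A_stable_def by (auto dest: spec[of _ "j - 1"])

lemma glat_mult_gen:
  assumes "A_stable p" "q \<in> glat p"
  shows "q * qgen g \<in> glat p"
proof -
  obtain u where u: "\<forall>i. qlook q i = to_fract (p i * u i)" by (rule glatE[OF assms(2)])
  have "\<exists>v. qlook (q * qgen g) j = to_fract (p j * v)" for j
  proof (cases g)
    case GX
    from A_stableD(1)[OF assms(1), of j] obtain w where "p (j - 1) = p j * w" by (auto elim: dvdE)
    then show ?thesis unfolding GX by (auto simp: qlook_mult_mono u mult.assoc simp flip: to_fract_mult)
  next
    case GY
    from A_stableD(2)[OF assms(1), of j] obtain w where w: "p (j + 1) * lin j ^ 2 = p j * w"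
      by (auto elim: dvdE)
    have "pcompose (lin (- 1)) [:of_int j + 1, 1:] = (lin j :: 'a poly)"
      using lin_shift[of "- 1" "j + 1"] by simp
    then have "qlook (q * qgen GY) j = to_fract (p (j + 1) * lin j ^ 2 * u (j + 1))"
      unfolding qgen_Y
      by (simp add: qlook_mult_mono u zshift_to_fract zshift_mult power2_eq_square lin_shift mult_ac)
    then show ?thesis unfolding GY w by (metis mult.assoc)
  next
    case GZ
    then show ?thesis unfolding GZ qgen_Z
      by (auto simp: qlook_mult_coef u mult.assoc simp flip: to_fract_mult)
  qed
  then show ?thesis by (simp add: glat_def)
qed

lemma q_eval_sum: "q_eval (sum f A) = (\<Sum>a\<in>A. q_eval (f a))"
  by (induction A rule: infinite_finite_induct) (auto simp: q_eval_add)

lemma glat_mult_q_eval: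
  assumes "A_stable p" "q \<in> glat p"
  shows "q * q_eval a \<in> glat p"
proof (induction a rule: poly_mapping_single_induct)
  case (add w c a)
  have "r * (\<Prod>g\<leftarrow>w. qgen g) \<in> glat p" if "r \<in> glat p" for r
    using that
  proof (induction w arbitrary: r)
    case (Cons g w)
    then show ?case using glat_mult_gen[OF assms(1)] by (simp flip: mult.assoc)
  qed simp
  moreover have "q * qcoef [:c:] \<in> glat p"
  proof -
    obtain u where "\<forall>i. qlook q i = to_fract (p i * u i)" by (rule glatE[OF assms(2)])
    then show ?thesis
      by (intro glatI[where u = "\<lambda>i. u i * [:c:]"])
         (simp add: qlook_mult_coef pcompose_pCons mult.assoc del: mult_pCons_right)
  qed
  ultimately show ?case using add
    by (simp add: q_eval_add q_eval_single distrib_left glat_add mult.assoc[symmetric])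
qed simp

section \<open>Rings given by generators and relations\<close>

lemma ideal_genideal_univ: "ideal (genideal univ_ring S) (univ_ring :: 'a::ring_1 ring)"
  by (rule ring.genideal_ideal[OF ring_univ_ring]) simp

lemma a_minus_univ [simp]: "p \<ominus>\<^bsub>univ_ring\<^esub> q = p - (q :: 'a::ring_1)"
proof -
  interpret R: ring "univ_ring :: 'a ring" by (rule ring_univ_ring)
  have "\<ominus>\<^bsub>univ_ring\<^esub> q = - q" by (rule R.minus_equality) simp_all
  then show ?thesis by (simp add: a_minus_def)
qed

lemma presented_class_eq_iff:
  "presented_class S p = presented_class S q \<longleftrightarrow> p - q \<in> genideal univ_ring S"
  using ring.quotient_eq_iff_same_a_r_cos[OF ring_univ_ring ideal_genideal_univ, of p q S]
  by (simp add: presented_class_def)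

lemma presented_class_hom: "presented_class S \<in> ring_hom univ_ring (presented_ring S)"
  using ideal.rcos_ring_hom[OF ideal_genideal_univ, of S]
  unfolding presented_class_def[abs_def] presented_ring_def .

lemma presented_ring_simps:
  "carrier (presented_ring S) = range (presented_class S)"
  "presented_class S p \<otimes>\<^bsub>presented_ring S\<^esub> presented_class S q = presented_class S (p * q)"
  "presented_class S p \<oplus>\<^bsub>presented_ring S\<^esub> presented_class S q = presented_class S (p + q)"
  "\<one>\<^bsub>presented_ring S\<^esub> = presented_class S 1"
proof -
  show "carrier (presented_ring S) = range (presented_class S)"
    by (auto simp: presented_ring_def FactRing_def A_RCOSETS_def' presented_class_def)
qed (use ring_hom_memE(2-4)[OF presented_class_hom[of S]] in simp_all)

lemma presented_class_zero: "presented_class S 0 = \<zero>\<^bsub>presented_ring S\<^esub>"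
  using ring_hom_zero[OF presented_class_hom ring_univ_ring ring_presented_ring, of S] by simp

lemma presented_class_rel: "p - q \<in> S \<Longrightarrow> presented_class S p = presented_class S q"
  using ring.genideal_self[OF ring_univ_ring, of S] by (auto simp: presented_class_eq_iff)

text \<open>The way in which the defining relations are applied inside sums and products of
  representatives.\<close>

lemma presented_class_cong:
  assumes "presented_class S p = presented_class S p'" "presented_class S q = presented_class S q'"
  shows "presented_class S (p + q) = presented_class S (p' + q')"
    and "presented_class S (p * q) = presented_class S (p' * q')"
  using assms by (metis presented_ring_simps(3), metis presented_ring_simps(2))

section \<open>A normal form in \<open>A(z\<^sup>2)\<close>\<close>

text \<open>The polynomial \<open>u(z)\<close>, as an element of the free algebra.\<close>

definition free_z :: "'k::field poly \<Rightarrow> 'k free_alg" where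
  "free_z u = fold_coeffs (\<lambda>a p. Poly_Mapping.single [] a + fgen GZ * p) u 0"

lemma free_z_0 [simp]: "free_z 0 = 0"
  by (simp add: free_z_def)

lemma free_z_pCons: "free_z (pCons a u) = Poly_Mapping.single [] a + fgen GZ * free_z u"
  by (cases "a = 0 \<and> u = 0") (auto simp: free_z_def)

lemma free_z_add: "free_z (u + v) = free_z u + free_z v"
  by (induction u v rule: poly_induct2) (simp_all add: free_z_pCons single_add algebra_simps)

lemma q_eval_free_z [simp]: "q_eval (free_z u) = qcoef u"
  by (induction u)
     (simp_all add: free_z_pCons q_eval_add q_eval_mult q_eval_single qcoef_mult qcoef_add)

lemma free_z_const_mult: "free_z ([:c:] * u) = Poly_Mapping.single [] c * free_z u"
proof (induction u)
  case (pCons a u)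
  have "Poly_Mapping.single [] c * fgen GZ = fgen GZ * Poly_Mapping.single [] c"
    by (simp add: fgen_def mult_single plus_list_def)
  then have "Poly_Mapping.single [] c * (fgen GZ * free_z u) = fgen GZ * (Poly_Mapping.single [] c * free_z u)"
    by (metis mult.assoc)
  then show ?case using pCons
    by (simp add: free_z_pCons distrib_left mult_single plus_list_def mult.commute)
qed simp

lemma free_z_mult: "free_z (u * v) = free_z u * free_z v"
proof (induction u)
  case (pCons a u)
  have "free_z (pCons a u * v) = free_z ([:a:] * v) + free_z (pCons 0 (u * v))"
    by (simp flip: free_z_add)
  then show ?case using pCons
    by (simp only: free_z_const_mult free_z_pCons) (simp add: distrib_right mult.assoc)
qed simp

lemma single_nil: "Poly_Mapping.single [] 1 = (1 :: 'k::field free_alg)"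
  using single_one[where 'a = "gen list"] unfolding zero_list_def .

lemma free_z_1: "free_z 1 = 1"
  by (simp add: free_z_def one_pCons single_nil)

lemma free_z_linear: "free_z [:c, 1:] = fgen GZ + Poly_Mapping.single [] c"
  by (simp add: free_z_pCons single_nil add.commute)

text \<open>The relations move \<open>x\<close> and \<open>y\<close> past \<open>z\<close>, hence past every polynomial in \<open>z\<close>.\<close>

lemma gen_free_z_comm:
  "A_class (fgen GX * free_z u) = A_class (free_z (pcompose u [:1, 1:]) * fgen GX)"
  "A_class (fgen GY * free_z u) = A_class (free_z (pcompose u [:- 1, 1:]) * fgen GY)"
proof -
  have *: "A_class (fgen g * free_z u) = A_class (free_z (pcompose u [:c, 1:]) * fgen g)"
    if rel: "A_class (fgen g * fgen GZ) = A_class (free_z [:c, 1:] * fgen g)" for g and c :: 'a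
  proof (induction u)
    case (pCons a u)
    let ?s = "Poly_Mapping.single ([] :: gen list) a"
    have s: "fgen g * ?s = ?s * fgen g" by (simp add: fgen_def mult_single plus_list_def)
    have "A_class (fgen g * fgen GZ * free_z u) = A_class (free_z [:c, 1:] * (fgen g * free_z u))"
      using presented_class_cong(2)[OF rel refl] by (simp add: mult.assoc)
    also have "\<dots> = A_class (free_z [:c, 1:] * (free_z (pcompose u [:c, 1:]) * fgen g))"
      by (rule presented_class_cong(2)[OF refl pCons.IH])
    finally have "A_class (fgen g * ?s + fgen g * fgen GZ * free_z u)
        = A_class (?s * fgen g + free_z [:c, 1:] * (free_z (pcompose u [:c, 1:]) * fgen g))"
      unfolding s by (rule presented_class_cong(1)[OF refl])
    moreover have "free_z (pcompose (pCons a u) [:c, 1:])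
        = ?s + free_z [:c, 1:] * free_z (pcompose u [:c, 1:])"
      by (simp only: pcompose_pCons free_z_add free_z_mult) (simp add: free_z_pCons)
    ultimately show ?case
      by (simp only: free_z_pCons distrib_left distrib_right mult.assoc)
  qed simp
  show "A_class (fgen GX * free_z u) = A_class (free_z (pcompose u [:1, 1:]) * fgen GX)"
    "A_class (fgen GY * free_z u) = A_class (free_z (pcompose u [:- 1, 1:]) * fgen GY)"
    by (rule *, rule presented_class_rel,
        simp add: A_rels_def Let_def free_z_linear single_nil single_uminus)+
qed

text \<open>The additive extension to finitely supported maps of a map given on singletons; normal forms
  and the comparison with the group ring are both of this kind.\<close>

definition lin_ext :: "('i \<Rightarrow> 'c \<Rightarrow> 'd) \<Rightarrow> ('i \<Rightarrow>\<^sub>0 'c::comm_monoid_add) \<Rightarrow> 'd::comm_monoid_add" where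
  "lin_ext f u = (\<Sum>i\<in>Poly_Mapping.keys u. f i (Poly_Mapping.lookup u i))"

lemma lin_ext_0 [simp]: "lin_ext f 0 = 0"
  by (simp add: lin_ext_def)

lemma lin_ext_superset:
  assumes "\<And>i. f i 0 = 0" "finite I" "Poly_Mapping.keys u \<subseteq> I"
  shows "lin_ext f u = (\<Sum>i\<in>I. f i (Poly_Mapping.lookup u i))"
  unfolding lin_ext_def
  by (rule sum.mono_neutral_left) (use assms in \<open>auto simp: in_keys_iff\<close>)

lemma lin_ext_single:
  assumes "\<And>i. f i 0 = 0"
  shows "lin_ext f (Poly_Mapping.single i c) = f i c"
  by (subst lin_ext_superset[of f "{i}"]) (auto simp: assms split: if_splits)

lemma lin_ext_add:
  assumes "\<And>i. f i 0 = 0" "\<And>i a b. f i (a + b) = f i a + f i b"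
  shows "lin_ext f (u + v) = lin_ext f u + lin_ext f v"
proof -
  have "Poly_Mapping.keys (u + v) \<subseteq> Poly_Mapping.keys u \<union> Poly_Mapping.keys v"
    by (rule keys_add)
  then show ?thesis
    by (subst (1 2 3) lin_ext_superset[of f "Poly_Mapping.keys u \<union> Poly_Mapping.keys v"])
       (auto simp: assms lookup_add sum.distrib)
qed

definition sq :: "int set \<Rightarrow> 'k::field poly" where
  "sq F = (\<Prod>j\<in>F. lin j ^ 2)"

lemma sq_nonzero [simp]: "sq F \<noteq> 0"
  by (cases "finite F") (auto simp: sq_def)

lemma sq_empty [simp]: "sq {} = 1"
  by (simp add: sq_def)

lemma sq_insert: "finite F \<Longrightarrow> j \<notin> F \<Longrightarrow> sq (insert j F) = lin j ^ 2 * sq F"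
  by (simp add: sq_def)

lemma sq_union: "finite F \<Longrightarrow> finite G \<Longrightarrow> F \<inter> G = {} \<Longrightarrow> sq (F \<union> G) = sq F * sq G"
  by (simp add: sq_def prod.union_disjoint)

lemma sq_diff: "finite F \<Longrightarrow> G \<subseteq> F \<Longrightarrow> sq F = sq G * sq (F - G)"
  using sq_union[of G "F - G"] finite_subset[of G F] by (simp add: Un_absorb1)

lemma sq_step: "i < n \<Longrightarrow> sq {i..<n} = lin i ^ 2 * sq {i + 1..<n}"
proof -
  assume "i < n"
  then have "{i..<n} = insert i {i + 1..<n}" by auto
  then show ?thesis by (simp add: sq_insert)
qed

text \<open>The words \<open>x\<^sup>i\<close> and \<open>y\<^sup>-\<^sup>i\<close>; they span \<open>A\<close> over \<open>k[z]\<close>.\<close>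

definition A_word :: "int \<Rightarrow> 'k::field free_alg" where
  "A_word i = (if 0 \<le> i then fgen GX ^ nat i else fgen GY ^ nat (- i))"

lemma A_word_int:
  "A_word (int n) = (fgen GX ^ n :: 'k::field free_alg)"
  "A_word (- int n) = (fgen GY ^ n :: 'k free_alg)"
  by (auto simp: A_word_def)

lemma q_eval_power: "q_eval (p ^ n) = q_eval p ^ n"
  by (induction n) (simp_all add: q_eval_mult)

text \<open>In the graded quotient ring \<open>y = (z - 1)\<^sup>2 x\<^sup>-\<^sup>1\<close>, whence
  \<open>y\<^sup>n = (z - 1)\<^sup>2 \<cdots> (z - n)\<^sup>2 x\<^sup>-\<^sup>n\<close>.\<close>

lemma q_eval_A_word: "q_eval (A_word i) = qmono (to_fract (sq {i..<0})) i"
proof (cases "0 \<le> i")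
  case True
  have "qmono 1 1 ^ n = (qmono 1 (int n) :: 'a qgr)" for n
    by (induction n) (simp_all add: qmono_mult flip: qmono_0_1)
  then show ?thesis using True by (simp add: A_word_def q_eval_power)
next
  case False
  have "qgen GY ^ n = (qmono (to_fract (sq {- int n..<0})) (- int n) :: 'a qgr)" for n
  proof (induction n)
    case (Suc n)
    have "{- 1 - int n..<0} = insert (- 1 - int n) {- int n..<0}" by auto
    then have "sq {- 1 - int n..<0} = lin (- 1 - int n) ^ 2 * (sq {- int n..<0} :: 'a poly)"
      by (simp add: sq_insert)
    moreover have "pcompose (lin (- 1) ^ 2) [:of_int (- int n), 1:] = (lin (- 1 - int n) ^ 2 :: 'a poly)"
      using lin_shift[of "- 1" "- int n", where 'a = 'a] by (simp add: power2_eq_square pcompose_mult add.commute)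
    moreover have "- int (Suc n) = - 1 - int n" "- int n + - 1 = - 1 - int n" by simp_all
    ultimately show ?case
      unfolding power_Suc2 Suc.IH unfolding qgen_Y qmono_mult zshift_to_fract
      by (simp only: mult.commute flip: to_fract_mult)
  qed (simp flip: qmono_0_1)
  from this[of "nat (- i)"] show ?thesis using False
    by (simp add: A_word_def q_eval_power del: qgen.simps)
qed

lemma A_stable_sq: "A_stable (\<lambda>i. sq {i..<n})"
  unfolding A_stable_def
proof
  fix i
  show "sq {i + 1..<n} dvd sq {i..<n} \<and> sq {i..<n} dvd sq {i + 1..<n} * lin i ^ 2"
  proof (cases "i < n")
    case True
    then show ?thesis unfolding sq_step[OF True] by (simp add: mult.commute)
  qed simp
qed

definition A_normal :: "(int \<Rightarrow>\<^sub>0 'k::field poly) \<Rightarrow> 'k free_alg" where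
  "A_normal = lin_ext (\<lambda>i c. free_z c * A_word i)"

lemma A_normal_add: "A_normal (u + v) = A_normal u + A_normal v"
  unfolding A_normal_def by (rule lin_ext_add) (simp_all add: free_z_add distrib_right)

lemma A_normal_single: "A_normal (Poly_Mapping.single i c) = free_z c * A_word i"
  unfolding A_normal_def by (rule lin_ext_single) simp

lemma gen_free_z_class: "\<exists>v. A_class (fgen g * free_z u) = A_class (free_z v * fgen g)"
proof (cases g)
  case GZ
  have "fgen GZ * free_z u = free_z ([:0, 1:] * u)"
    by (simp only: free_z_mult) (simp add: free_z_linear)
  also have "\<dots> = free_z u * fgen GZ"
    by (subst mult.commute, simp only: free_z_mult) (simp add: free_z_linear)
  finally show ?thesis using GZ by metis
qed (use gen_free_z_comm in blast)+

text \<open>A generator either lengthens a word or, by \<open>xy = z\<^sup>2\<close> and \<open>yx = (z - 1)\<^sup>2\<close>, cancels its first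
  letter at the price of a polynomial.\<close>

lemma gen_word_class: "\<exists>v j. A_class (fgen g * A_word i) = A_class (free_z v * A_word j)"
proof (cases g)
  case GX
  show ?thesis
  proof (cases "0 \<le> i")
    case True
    then have "fgen GX * A_word i = free_z 1 * (A_word (i + 1) :: 'a free_alg)"
      by (simp add: A_word_def free_z_1 nat_add_distrib)
    then show ?thesis unfolding GX by metis
  next
    case False
    then have "i = - int (Suc (nat (- i - 1)))" "i + 1 = - int (nat (- i - 1))" by simp_all
    then have "A_word i = fgen GY * (A_word (i + 1) :: 'a free_alg)"
      by (metis A_word_int(2) power_Suc)
    moreover have "A_class (fgen GX * fgen GY) = A_class (free_z ([:0, 1:] * [:0, 1:]) :: 'a free_alg)"
      by (rule presented_class_rel, simp only: free_z_mult)
         (simp add: A_rels_def Let_def free_z_linear power2_eq_square)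
    ultimately have "A_class (fgen GX * A_word i)
        = A_class (free_z ([:0, 1:] * [:0, 1:]) * A_word (i + 1) :: 'a free_alg)"
      using presented_class_cong(2)[OF _ refl] by (simp only: flip: mult.assoc)
    then show ?thesis unfolding GX by blast
  qed
next
  case GY
  show ?thesis
  proof (cases "i \<le> 0")
    case True
    then have "i - 1 = - int (Suc (nat (- i)))" "i = - int (nat (- i))" by simp_all
    then have "fgen GY * A_word i = free_z 1 * (A_word (i - 1) :: 'a free_alg)"
      by (metis A_word_int(2) power_Suc free_z_1 mult_1)
    then show ?thesis using GY by metis
  next
    case False
    then have "i = int (Suc (nat (i - 1)))" "i - 1 = int (nat (i - 1))" by simp_all
    then have "A_word i = fgen GX * (A_word (i - 1) :: 'a free_alg)"
      by (metis A_word_int(1) power_Suc)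
    moreover have "A_class (fgen GY * fgen GX) = A_class (free_z ([:- 1, 1:] * [:- 1, 1:]) :: 'a free_alg)"
      by (rule presented_class_rel, simp only: free_z_mult)
         (simp add: A_rels_def Let_def free_z_linear power2_eq_square single_nil single_uminus)
    ultimately have "A_class (fgen GY * A_word i)
        = A_class (free_z ([:- 1, 1:] * [:- 1, 1:]) * A_word (i - 1) :: 'a free_alg)"
      using presented_class_cong(2)[OF _ refl] by (simp only: flip: mult.assoc)
    then show ?thesis unfolding GY by blast
  qed
next
  case GZ
  then show ?thesis using free_z_linear[of 0] by (metis add.right_neutral single_zero)
qed

lemma gen_normal_class: "\<exists>v. A_class (fgen g * A_normal u) = A_class (A_normal v)"
proof (induction u rule: poly_mapping_single_induct)
  case zero
  then show ?case by (intro exI[of _ 0]) (simp add: A_normal_def)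
next
  case (add i c u)
  then obtain v where v: "A_class (fgen g * A_normal u) = A_class (A_normal v)" by blast
  obtain d where d: "A_class (fgen g * free_z c) = A_class (free_z d * fgen g)"
    using gen_free_z_class by blast
  obtain e j where e: "A_class (fgen g * A_word i) = A_class (free_z e * A_word j :: 'a free_alg)"
    using gen_word_class by blast
  have "A_class (fgen g * (free_z c * A_word i)) = A_class (free_z d * (fgen g * A_word i))"
    using presented_class_cong(2)[OF d refl] by (simp add: mult.assoc)
  also have "\<dots> = A_class (free_z d * (free_z e * A_word j))"
    by (rule presented_class_cong(2)[OF refl e])
  also have "\<dots> = A_class (A_normal (Poly_Mapping.single j (d * e)))"
    by (simp add: A_normal_single free_z_mult mult.assoc)
  finally have "A_class (fgen g * A_normal (Poly_Mapping.single i c + u))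
      = A_class (A_normal (Poly_Mapping.single j (d * e) + v))"
    unfolding A_normal_add distrib_left A_normal_single by (rule presented_class_cong(1)[OF _ v])
  then show ?case by blast
qed

text \<open>The combinations of the words \<open>A_word i\<close> with coefficients in \<open>k[z]\<close> are closed under left
  multiplication by the generators and contain the constants.\<close>

lemma A_normal_form: "\<exists>u. A_class p = A_class (A_normal u)"
proof (induction p rule: poly_mapping_single_induct)
  case zero
  then show ?case by (intro exI[of _ 0]) (simp add: A_normal_def)
next
  case (add w c p)
  have "\<exists>u. A_class (Poly_Mapping.single w c) = A_class (A_normal u)"
  proof (induction w)
    case Nil
    show ?case
      by (intro exI[of _ "Poly_Mapping.single 0 [:c:]"])
         (simp add: A_normal_single A_word_def free_z_pCons)
  next
    case (Cons g w)
    then obtain u where "A_class (Poly_Mapping.single w c) = A_class (A_normal u)" by blast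
    then have "A_class (fgen g * Poly_Mapping.single w c) = A_class (fgen g * A_normal u)"
      by (rule presented_class_cong(2)[OF refl])
    then show ?case using gen_normal_class[of g u]
      by (simp add: fgen_def mult_single plus_list_def)
  qed
  then obtain u where u: "A_class (Poly_Mapping.single w c) = A_class (A_normal u)" by blast
  obtain v where v: "A_class p = A_class (A_normal v)" using add by blast
  have "A_class (Poly_Mapping.single w c + p) = A_class (A_normal (u + v))"
    unfolding A_normal_add by (rule presented_class_cong(1)[OF u v])
  then show ?case by blast
qed

lemma q_eval_normal: "qlook (q_eval (A_normal u)) i = to_fract (Poly_Mapping.lookup u i * sq {i..<0})"
  by (induction u rule: poly_mapping_single_induct)
     (auto simp: A_normal_add A_normal_single q_eval_add q_eval_mult q_eval_A_word lookup_add
        lookup_single when_def distrib_right, simp add: A_normal_def)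

text \<open>Injectivity of \<open>A \<rightarrow> k(z)[x\<^sup>\<plusminus>\<^sup>1; \<sigma>]\<close>: in a normal form the words have different degrees and
  nonzero images, so the coefficients can be read off from the image.\<close>

lemma q_eval_eq_iff: "q_eval p = q_eval q \<longleftrightarrow> A_class p = A_class q"
proof
  assume "A_class p = A_class q"
  then show "q_eval p = q_eval q" by (metis A_emb_class)
next
  assume eq: "q_eval p = q_eval q"
  obtain u where u: "A_class (p - q) = A_class (A_normal u)" using A_normal_form by blast
  have "q_eval (p - q) = 0" using eq q_eval_add[of "p - q" q] by simp
  then have "q_eval (A_normal u) = 0" using u by (metis A_emb_class)
  then have "u = 0"
    using q_eval_normal[of u] by (intro poly_mapping_eqI) simp
  then have "A_class (p - q) = A_class 0" using u by (simp add: A_normal_def)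
  then show "A_class p = A_class q" by (simp add: presented_class_eq_iff)
qed

lemma A_sub_range: "A_sub = range q_eval"
  by (simp add: A_sub_def algA_def presented_ring_simps(1) image_image A_emb_class)

lemma A_sub_glat: "(A_sub :: 'a::field qgr set) = glat (\<lambda>i. sq {i..<0})"
proof
  show "(A_sub :: 'a qgr set) \<subseteq> glat (\<lambda>i. sq {i..<0})"
  proof -
    have "(1 :: 'a qgr) \<in> glat (\<lambda>i. sq {i..<0})"
      using qmono_in_glat[of 1 0 "\<lambda>i. sq {i..<0}"] by (simp add: qmono_0_1)
    then have "1 * q_eval a \<in> glat (\<lambda>i. sq {i..<0})" for a :: "'a free_alg"
      by (rule glat_mult_q_eval[OF A_stable_sq])
    then show ?thesis unfolding A_sub_range by auto
  qed
  show "glat (\<lambda>i. sq {i..<0}) \<subseteq> (A_sub :: 'a qgr set)"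
  proof
    fix q :: "'a qgr" assume "q \<in> glat (\<lambda>i. sq {i..<0})"
    then obtain u where u: "\<forall>i. qlook q i = to_fract (sq {i..<0} * u i)" by (rule glatE)
    have "q = (\<Sum>i | qlook q i \<noteq> 0. qmono (qlook q i) i)" by (rule qgr_expand)
    also have "\<dots> = q_eval (\<Sum>i | qlook q i \<noteq> 0. free_z (u i) * A_word i)"
      unfolding q_eval_sum q_eval_mult q_eval_free_z q_eval_A_word
      using u by (intro sum.cong refl) (simp add: qcoef_def qmono_mult mult.commute)
    finally show "q \<in> A_sub" by (auto simp: A_sub_range)
  qed
qed

section \<open>Cyclic graded modules as quotients of lattices\<close>

definition homogeneous :: "int \<Rightarrow> 'k::field free_alg \<Rightarrow> bool" where
  "homogeneous i p \<longleftrightarrow> (\<forall>w\<in>Poly_Mapping.keys p. (\<Sum>g\<leftarrow>w. gen_deg g) = i)"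

lemma homogeneous_0: "homogeneous i 0"
  by (simp add: homogeneous_def)

lemma homogeneous_add: "homogeneous i p \<Longrightarrow> homogeneous i q \<Longrightarrow> homogeneous i (p + q)"
  unfolding homogeneous_def using keys_add[of p q] by blast

lemma homogeneous_mult:
  assumes "homogeneous i p" "homogeneous j q"
  shows "homogeneous (i + j) (p * q)"
  unfolding homogeneous_def
proof
  fix w assume "w \<in> Poly_Mapping.keys (p * q)"
  then obtain u v where "u \<in> Poly_Mapping.keys p" "v \<in> Poly_Mapping.keys q" "w = u @ v"
    using keys_mult[of p q] by (auto simp: plus_list_def)
  then show "(\<Sum>g\<leftarrow>w. gen_deg g) = i + j" using assms by (simp add: homogeneous_def)
qed

lemma homogeneous_single: "homogeneous (\<Sum>g\<leftarrow>w. gen_deg g) (Poly_Mapping.single w c)"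
  by (simp add: homogeneous_def)

lemma homogeneous_gen: "homogeneous (gen_deg g) (fgen g)"
  unfolding fgen_def using homogeneous_single[of "[g]"] by simp

lemma homogeneous_free_z: "homogeneous 0 (free_z u)"
proof (induction u)
  case (pCons a u)
  have "homogeneous 0 (Poly_Mapping.single [] a)" using homogeneous_single[of "[]"] by simp
  moreover have "homogeneous 0 (fgen GZ * free_z u)"
    using homogeneous_mult[OF homogeneous_gen[of GZ] pCons.IH] by simp
  ultimately show ?case unfolding free_z_pCons by (rule homogeneous_add)
qed (simp add: homogeneous_0)

lemma homogeneous_power: "homogeneous i p \<Longrightarrow> homogeneous (int n * i) (p ^ n)"
proof (induction n)
  case 0
  have "homogeneous 0 (Poly_Mapping.single [] 1)" using homogeneous_single[of "[]"] by simp
  then show ?case by (simp add: single_nil)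
next
  case (Suc n)
  then show ?case using homogeneous_mult[of i p "int n * i" "p ^ n"] by (simp add: algebra_simps)
qed

lemma homogeneous_A_word: "homogeneous i (A_word i)"
  using homogeneous_power[OF homogeneous_gen[of GX], of "nat i"]
    homogeneous_power[OF homogeneous_gen[of GY], of "nat (- i)"] by (auto simp: A_word_def)

lemma q_comp_mult: "a \<in> q_comp i \<Longrightarrow> b \<in> q_comp j \<Longrightarrow> a * b \<in> q_comp (i + j)"
  by (auto simp: q_comp_def qmono_mult)

lemma qgen_comp: "qgen g \<in> q_comp (gen_deg g)"
  by (cases g) (auto simp: qgen_Y q_comp_def qcoef_def simp del: qgen.simps(2))

lemma q_eval_homogeneous:
  assumes "homogeneous i p"
  shows "q_eval p \<in> q_comp i"
proof -
  have word: "(\<Prod>g\<leftarrow>w. qgen g) \<in> q_comp (\<Sum>g\<leftarrow>w. gen_deg g)" for w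
    by (induction w)
       (use qmono_0_1 in \<open>auto simp: q_comp_def simp del: qgen.simps
          intro!: q_comp_mult[unfolded q_comp_def] qgen_comp[unfolded q_comp_def]\<close>)
  have "qcoef [:Poly_Mapping.lookup p w:] * (\<Prod>g\<leftarrow>w. qgen g) \<in> q_comp i"
    if "w \<in> Poly_Mapping.keys p" for w
    using q_comp_mult[of "qcoef [:Poly_Mapping.lookup p w:]" 0, OF _ word[of w]] that assms
    by (auto simp: homogeneous_def q_comp_def qcoef_def)
  then show ?thesis unfolding q_eval_def q_comp_iff qlook_sum by (auto intro: sum.neutral)
qed

text \<open>By injectivity of the embedding, the grading of \<open>A\<close> by word degree is induced from that of the
  graded quotient ring.\<close>

lemma A_comp_eq: "A_comp i = {A_class p | p. q_eval p \<in> q_comp i}"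
proof (intro equalityI subsetI)
  fix C :: "'a free_alg set" assume "C \<in> A_comp i"
  then show "C \<in> {A_class p | p. q_eval p \<in> q_comp i}"
    using q_eval_homogeneous by (fastforce simp: A_comp_def homogeneous_def)
next
  fix C :: "'a free_alg set" assume "C \<in> {A_class p | p. q_eval p \<in> q_comp i}"
  then obtain p where p: "C = A_class p" "q_eval p \<in> q_comp i" by blast
  have "q_eval p \<in> glat (\<lambda>i. sq {i..<0})" using A_sub_glat A_sub_range by blast
  then obtain u where u: "\<forall>i. qlook (q_eval p) i = to_fract (sq {i..<0} * u i)" by (rule glatE)
  have "q_eval p = q_eval (free_z (u i) * A_word i)"
    by (rule qgr_eqI)
       (use p(2) u in \<open>auto simp: q_comp_iff q_eval_mult q_eval_A_word mult.commute\<close>)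
  then have "C = A_class (free_z (u i) * A_word i)" using p(1) by (simp add: q_eval_eq_iff)
  moreover have "homogeneous i (free_z (u i) * A_word i)"
    using homogeneous_mult[OF homogeneous_free_z homogeneous_A_word] by simp
  ultimately show "C \<in> A_comp i" by (auto simp: A_comp_def homogeneous_def)
qed

lemma algA_simps [simp]:
  "carrier algA = range A_class"
  "A_class p \<otimes>\<^bsub>algA\<^esub> A_class q = A_class (p * q)"
  "A_class p \<oplus>\<^bsub>algA\<^esub> A_class q = A_class (p + q)"
  by (simp_all add: algA_def presented_ring_simps)

lemma q_eval_uminus: "q_eval (- p) = - q_eval p"
  using q_eval_add[of p "- p"] by (simp add: eq_neg_iff_add_eq_0 add.commute)

lemma q_eval_diff: "q_eval (p - q) = q_eval p - q_eval q"
  using q_eval_add[of p "- q"] by (simp add: q_eval_uminus)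

lemma pcompose_shift_inverse: "pcompose (pcompose (u :: 'a::field poly) [:of_int (- i), 1:]) [:of_int i, 1:] = u"
  by (simp add: pcompose_pCons pcompose_idR flip: pcompose_assoc)

text \<open>Because of \<open>x\<^sup>i u(z) = u(z + i) x\<^sup>i\<close>, right multiplication by a shifted polynomial has the effect of
  left multiplication by the polynomial itself.\<close>

lemma q_eval_range_mono:
  assumes "q_eval t = qmono (to_fract d) i"
  obtains r where "q_eval (t * r) = qmono (to_fract (d * u)) i"
proof
  show "q_eval (t * free_z (pcompose u [:of_int (- i), 1:])) = qmono (to_fract (d * u)) i"
    using assms by (simp add: q_eval_mult qcoef_def qmono_mult zshift_to_fract
        pcompose_shift_inverse[of u i, simplified])
qed

text \<open>The lattice \<open>glat d\<close> corresponds to a right ideal. By hypothesis each of its generators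
  \<open>d\<^sub>i x\<^sup>i\<close> is a right multiple of an element of \<open>T\<close>, so \<open>T\<close> generates it.\<close>

lemma right_ideal_gen_glat:
  assumes d: "A_stable d" and T: "\<And>s. s \<in> T \<Longrightarrow> q_eval s \<in> glat d"
    and gen: "\<And>i. \<exists>s\<in>T. \<exists>t. q_eval (s * t) = qmono (to_fract (d i)) i"
  shows "right_ideal_gen (A_class ` T) = {A_class r | r. q_eval r \<in> glat d}" (is "_ = ?I")
proof
  interpret A: ring algA unfolding algA_def by (rule ring_presented_ring)
  have 1: "additive_subgroup ?I algA"
  proof (rule additive_subgroup.intro, rule A.add.subgroupI)
    fix C assume "C \<in> ?I"
    then obtain r where r: "C = A_class r" "q_eval r \<in> glat d" by blast
    have "A_class (- r) \<oplus>\<^bsub>algA\<^esub> A_class r = \<zero>\<^bsub>algA\<^esub>"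
      by (simp add: presented_class_zero flip: algA_def)
    then have "\<ominus>\<^bsub>algA\<^esub> C = A_class (- r)"
      unfolding r by (intro A.minus_equality) auto
    then show "\<ominus>\<^bsub>algA\<^esub> C \<in> ?I" using r by (auto simp: q_eval_uminus intro!: glat_uminus)
  next
    fix C D assume "C \<in> ?I" "D \<in> ?I"
    then obtain r s where "C = A_class r" "q_eval r \<in> glat d" "D = A_class s" "q_eval s \<in> glat d"
      by blast
    then have "C \<oplus>\<^bsub>algA\<^esub> D = A_class (r + s)" "q_eval (r + s) \<in> glat d"
      by (simp_all add: q_eval_add glat_add)
    then show "C \<oplus>\<^bsub>algA\<^esub> D \<in> ?I" by blast
  qed (auto intro: exI[of _ 0])
  have 2: "a \<otimes>\<^bsub>algA\<^esub> r \<in> ?I" if a: "a \<in> ?I" and r: "r \<in> carrier algA" for a r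
  proof -
    from a r obtain s t where "a = A_class s" "q_eval s \<in> glat d" "r = A_class t" by auto
    then have "a \<otimes>\<^bsub>algA\<^esub> r = A_class (s * t)" "q_eval (s * t) \<in> glat d"
      by (simp_all add: q_eval_mult glat_mult_q_eval[OF d])
    then show ?thesis by blast
  qed
  have 3: "A_class ` T \<subseteq> ?I" using T by blast
  show "right_ideal_gen (A_class ` T) \<subseteq> ?I"
    unfolding right_ideal_gen_def
    by (rule Inter_lower, rule CollectI, intro conjI ballI, rule 1, rule 3, rule 2)
next
  show "?I \<subseteq> right_ideal_gen (A_class ` T)"
    unfolding right_ideal_gen_def
  proof (intro Inter_greatest subsetI)
    fix I C
    assume "I \<in> {I. additive_subgroup I algA \<and> A_class ` T \<subseteq> I \<and>
      (\<forall>a\<in>I. \<forall>r\<in>carrier algA. a \<otimes>\<^bsub>algA\<^esub> r \<in> I)}"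
    then have I: "additive_subgroup I algA" "A_class ` T \<subseteq> I"
      "\<And>a r. a \<in> I \<Longrightarrow> r \<in> carrier algA \<Longrightarrow> a \<otimes>\<^bsub>algA\<^esub> r \<in> I" by blast+
    interpret I: additive_subgroup I algA by fact
    assume "C \<in> ?I"
    then obtain r where r: "C = A_class r" "q_eval r \<in> glat d" by blast
    obtain u where u: "\<forall>i. qlook (q_eval r) i = to_fract (d i * u i)" using r(2) by (rule glatE)
    have "\<exists>t. A_class t \<in> I \<and> q_eval t = qmono (to_fract (d i * u i)) i" for i
    proof -
      obtain s t where s: "s \<in> T" "q_eval (s * t) = qmono (to_fract (d i)) i" using gen by blast
      obtain v where v: "q_eval (s * t * v) = qmono (to_fract (d i * u i)) i"
        using q_eval_range_mono[OF s(2)] .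
      have "A_class s \<otimes>\<^bsub>algA\<^esub> A_class (t * v) \<in> I" by (rule I(3)) (use I(2) s(1) in auto)
      then show ?thesis using v by (auto simp: mult.assoc)
    qed
    then obtain t where t: "\<And>i. A_class (t i) \<in> I" "\<And>i. q_eval (t i) = qmono (qlook (q_eval r) i) i"
      using u by metis
    have "q_eval r = q_eval (\<Sum>i | qlook (q_eval r) i \<noteq> 0. t i)"
      unfolding q_eval_sum t(2) by (rule qgr_expand)
    then have "C = A_class (\<Sum>i | qlook (q_eval r) i \<noteq> 0. t i)" using r by (simp add: q_eval_eq_iff)
    moreover have "A_class (sum t F) \<in> I" for F
    proof (induction F rule: infinite_finite_induct)
      case (insert i F)
      then show ?case using I.a_closed[OF t(1)[of i] insert.IH] by simp
    qed (use I.zero_closed in \<open>simp_all add: algA_def presented_class_zero\<close>)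
    ultimately show "C \<in> I" by simp
  qed
qed

text \<open>The module \<open>M\<close> is the quotient of the lattice \<open>glat a\<close> by \<open>glat d\<close>, with projection \<open>cl\<close>.\<close>

locale lattice_quotient =
  fixes M :: "('k::field free_alg set, 'm) grmod" and a d :: "int \<Rightarrow> 'k poly" and cl :: "'k qgr \<Rightarrow> 'm"
  assumes carrier_eq: "mcarrier M = cl ` glat a"
    and cl_eq_iff: "q \<in> glat a \<Longrightarrow> q' \<in> glat a \<Longrightarrow> cl q = cl q' \<longleftrightarrow> q - q' \<in> glat d"
    and madd_cl: "q \<in> glat a \<Longrightarrow> q' \<in> glat a \<Longrightarrow> madd M (cl q) (cl q') = cl (q + q')"
    and mact_cl: "q \<in> glat a \<Longrightarrow> mact M (cl q) (A_class p) = cl (q * q_eval p)"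
    and mcomp_eq: "mcomp M i = cl ` (glat a \<inter> q_comp i)"
    and mzero_eq: "mzero M = cl 0"

text \<open>The coset in \<open>A / \<langle>T\<rangle>A\<close> of an element with image \<open>q\<close> in the graded quotient ring consists of
  the elements whose image differs from \<open>q\<close> by an element of \<open>glat d\<close>; this describes all
  operations of the module on the side of the lattices.\<close>

lemma lattice_quotient_A_mod:
  assumes d: "A_stable d" and T: "\<And>s. s \<in> T \<Longrightarrow> q_eval s \<in> glat d"
    and gen: "\<And>i. \<exists>s\<in>T. \<exists>t. q_eval (s * t) = qmono (to_fract (d i)) i"
  shows "\<exists>cl. lattice_quotient (A_mod (A_class ` T)) (\<lambda>i. sq {i..<0}) d cl"
proof -
  let ?I = "right_ideal_gen (A_class ` T)"
  define cl where "cl q = {A_class r | r. q_eval r - q \<in> glat d}" for q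
  have I: "?I = {A_class r | r. q_eval r \<in> glat d}" by (rule right_ideal_gen_glat[OF assms])
  have coset: "?I +>\<^bsub>algA\<^esub> A_class p = cl (q_eval p)" for p
  proof (intro equalityI subsetI)
    fix C assume "C \<in> ?I +>\<^bsub>algA\<^esub> A_class p"
    then obtain r where "q_eval r \<in> glat d" "C = A_class (r + p)"
      by (auto simp: a_r_coset_def' I)
    then show "C \<in> cl (q_eval p)" unfolding cl_def by (fastforce simp: q_eval_add)
  next
    fix C assume "C \<in> cl (q_eval p)"
    then obtain r where "q_eval r - q_eval p \<in> glat d" "C = A_class r" by (auto simp: cl_def)
    then have "q_eval (r - p) \<in> glat d" "C = A_class (r - p) \<oplus>\<^bsub>algA\<^esub> A_class p"
      by (simp_all add: q_eval_diff)
    then show "C \<in> ?I +>\<^bsub>algA\<^esub> A_class p" unfolding a_r_coset_def' I by blast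
  qed
  have lat: "q_eval p \<in> glat (\<lambda>i. sq {i..<0})" for p :: "'a free_alg"
    using A_sub_glat A_sub_range by blast
  have rep: "\<exists>p. q = q_eval p" if "q \<in> glat (\<lambda>i. sq {i..<0})" for q :: "'a qgr"
    using that unfolding A_sub_glat[symmetric] A_sub_range by blast
  have eq_iff: "cl q = cl q' \<longleftrightarrow> q - q' \<in> glat d"
    if q: "q \<in> glat (\<lambda>i. sq {i..<0})" and q': "q' \<in> glat (\<lambda>i. sq {i..<0})" for q q'
  proof
    obtain p where p: "q = q_eval p" using rep[OF q] by blast
    assume "cl q = cl q'"
    moreover have "A_class p \<in> cl q" unfolding cl_def p by (intro CollectI exI[of _ p]) simp
    ultimately have "A_class p \<in> cl q'" by simp
    then obtain r where "A_class p = A_class r" "q_eval r - q' \<in> glat d" by (auto simp: cl_def)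
    then show "q - q' \<in> glat d" by (simp add: p flip: q_eval_eq_iff)
  next
    assume *: "q - q' \<in> glat d"
    have "r - q \<in> glat d \<longleftrightarrow> r - q' \<in> glat d" for r
      using glat_add[of "r - q" d "q - q'"] glat_diff[of "r - q'" d "q - q'"] * by auto
    then show "cl q = cl q'" by (simp add: cl_def)
  qed
  have "lattice_quotient (A_mod (A_class ` T)) (\<lambda>i. sq {i..<0}) d cl"
  proof
    show "mcarrier (A_mod (A_class ` T)) = cl ` glat (\<lambda>i. sq {i..<0})"
      by (auto simp: A_mod_def Let_def A_RCOSETS_def' coset A_sub_range simp flip: A_sub_glat)
    show "madd (A_mod (A_class ` T)) (cl q) (cl q') = cl (q + q')"
      if q: "q \<in> glat (\<lambda>i. sq {i..<0})" and q': "q' \<in> glat (\<lambda>i. sq {i..<0})" for q q'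
    proof -
      obtain p where p: "q = q_eval p" using rep[OF q] by blast
      have "cl q <+>\<^bsub>algA\<^esub> cl q' = cl (q + q')"
      proof (intro equalityI subsetI)
        fix C assume "C \<in> cl q <+>\<^bsub>algA\<^esub> cl q'"
        then obtain r s where "C = A_class (r + s)" "q_eval r - q \<in> glat d" "q_eval s - q' \<in> glat d"
          by (auto simp: set_add_def' cl_def)
        then show "C \<in> cl (q + q')"
          using glat_add[of "q_eval r - q" d "q_eval s - q'"]
          by (auto simp: cl_def q_eval_add algebra_simps intro!: exI[of _ "r + s"])
      next
        fix C assume "C \<in> cl (q + q')"
        then obtain r where r: "C = A_class r" "q_eval r - (q + q') \<in> glat d" by (auto simp: cl_def)
        have "A_class p \<in> cl q" unfolding cl_def p by (intro CollectI exI[of _ p]) simp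
        moreover have "A_class (r - p) \<in> cl q'"
          using r(2) by (auto simp: cl_def p q_eval_diff diff_diff_eq)
        moreover have "C = A_class p \<oplus>\<^bsub>algA\<^esub> A_class (r - p)" using r(1) by simp
        ultimately show "C \<in> cl q <+>\<^bsub>algA\<^esub> cl q'" unfolding set_add_def' by blast
      qed
      then show ?thesis by (simp add: A_mod_def Let_def)
    qed
    show "mact (A_mod (A_class ` T)) (cl q) (A_class p) = cl (q * q_eval p)"
      if q: "q \<in> glat (\<lambda>i. sq {i..<0})" for q p
    proof -
      obtain s where s: "q = q_eval s" using rep q by blast
      have *: "?I +>\<^bsub>algA\<^esub> (c \<otimes>\<^bsub>algA\<^esub> A_class p) = cl (q * q_eval p)" if c: "c \<in> cl q" for c
      proof -
        obtain r where r: "c = A_class r" "q_eval r - q \<in> glat d" using c by (auto simp: cl_def)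
        have "q_eval r * q_eval p - q * q_eval p \<in> glat d"
          using glat_mult_q_eval[OF d r(2), of p] by (simp add: left_diff_distrib)
        then have "cl (q_eval (r * p)) = cl (q_eval (s * p))"
          unfolding s eq_iff[OF lat lat] by (simp add: q_eval_mult)
        then show ?thesis by (simp add: r(1) coset s q_eval_mult)
      qed
      have "A_class s \<in> cl q" unfolding cl_def s by (intro CollectI exI[of _ s]) simp
      then show ?thesis by (auto simp: A_mod_def Let_def *)
    qed
    show "mcomp (A_mod (A_class ` T)) i = cl ` (glat (\<lambda>i. sq {i..<0}) \<inter> q_comp i)" for i
    proof -
      have "A_comp i = A_class ` {p :: 'a free_alg. q_eval p \<in> q_comp i}"
        unfolding A_comp_eq by blast
      moreover have "glat (\<lambda>i. sq {i..<0}) \<inter> q_comp i = q_eval ` {p :: 'a free_alg. q_eval p \<in> q_comp i}"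
        unfolding A_sub_glat[symmetric] A_sub_range by blast
      ultimately show ?thesis by (simp add: A_mod_def Let_def image_image coset)
    qed
    show "mzero (A_mod (A_class ` T)) = cl 0"
      by (simp add: A_mod_def Let_def I cl_def)
  qed (use eq_iff in auto)
  then show ?thesis by (rule exI[of _ cl])
qed

text \<open>The lattice \<open>x\<^sup>n (glat p)\<close>, which is isomorphic to \<open>(glat p)\<langle>n\<rangle>\<close>.\<close>

definition lat_shift :: "int \<Rightarrow> (int \<Rightarrow> 'k::field poly) \<Rightarrow> int \<Rightarrow> 'k poly" where
  "lat_shift n p i = pcompose (p (i - n)) [:of_int n, 1:]"

lemma zshift_inject [simp]: "zshift n f = zshift n g \<longleftrightarrow> f = g"
  by (metis add.left_inverse zshift_zero_left zshift_zshift)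

lemma glat_lat_shift: "q \<in> glat (lat_shift n p) \<longleftrightarrow> qmono 1 (- n) * q \<in> glat p"
proof -
  have *: "to_fract (lat_shift n p i * pcompose u [:of_int n, 1:]) = zshift n (to_fract (p (i - n) * u))" for i u
    by (simp only: zshift_to_fract lat_shift_def pcompose_mult)
  have inv: "u = pcompose (pcompose u [:of_int (- n), 1:]) [:of_int n, 1:]" for u :: "'a poly"
    using pcompose_shift_inverse[of u n] by simp
  have "(\<exists>u. qlook q i = to_fract (lat_shift n p i * u))
      \<longleftrightarrow> (\<exists>u. zshift (- n) (qlook q i) = to_fract (p (i - n) * u))" for i
  proof -
    have "(\<exists>u. qlook q i = to_fract (lat_shift n p i * u))
        \<longleftrightarrow> (\<exists>u. qlook q i = zshift n (to_fract (p (i - n) * u)))"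
      using * inv by metis
    also have "\<dots> \<longleftrightarrow> (\<exists>u. zshift (- n) (qlook q i) = to_fract (p (i - n) * u))"
      by (metis add.left_inverse add.right_inverse zshift_zero_left zshift_zshift)
    finally show ?thesis .
  qed
  moreover have "(\<forall>i. P i) \<longleftrightarrow> (\<forall>i. P (i - n))" for P :: "int \<Rightarrow> bool"
    by (metis add_diff_cancel_right')
  ultimately show ?thesis
    unfolding glat_def mem_Collect_eq qlook_mono_mult mult_1
    by (metis (no_types, lifting) add_diff_cancel_right' diff_minus_eq_add)
qed

lemma qmono_cancel: "qmono 1 n * (qmono 1 (- n) * q) = q" "qmono 1 (- n) * (qmono 1 n * q) = q"
  by (simp_all add: qmono_mult qmono_0_1 flip: mult.assoc)

lemma lattice_quotient_shift:
  assumes "lattice_quotient M a d cl"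
  shows "lattice_quotient (gr_shift M n) (lat_shift n a) (lat_shift n d) (\<lambda>q. cl (qmono 1 (- n) * q))"
proof -
  interpret lattice_quotient M a d cl by fact
  have img: "(\<lambda>q. cl (qmono 1 (- n) * q)) ` {q \<in> glat (lat_shift n a). P (qmono 1 (- n) * q)}
      = cl ` {q \<in> glat a. P q}" for P
  proof (intro equalityI subsetI)
    fix x assume "x \<in> cl ` {q \<in> glat a. P q}"
    then obtain q where "x = cl q" "q \<in> glat a" "P q" by blast
    then show "x \<in> (\<lambda>q. cl (qmono 1 (- n) * q)) ` {q \<in> glat (lat_shift n a). P (qmono 1 (- n) * q)}"
      by (intro image_eqI[where x = "qmono 1 n * q"]) (auto simp: glat_lat_shift qmono_cancel)
  qed (auto simp: glat_lat_shift)
  have comp: "qmono 1 (- n) * q \<in> q_comp (i - n) \<longleftrightarrow> q \<in> q_comp i" for q :: "'a qgr" and i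
    unfolding q_comp_iff qlook_mono_mult
    by (auto, metis add_diff_cancel_right' diff_add_cancel zshift_0 zshift_inject)
  show ?thesis
  proof
    show "mcarrier (gr_shift M n) = (\<lambda>q. cl (qmono 1 (- n) * q)) ` glat (lat_shift n a)"
      using img[of "\<lambda>_. True"] by (simp add: gr_shift_def carrier_eq)
    show "mcomp (gr_shift M n) i = (\<lambda>q. cl (qmono 1 (- n) * q)) ` (glat (lat_shift n a) \<inter> q_comp i)" for i
      using img[of "\<lambda>q. q \<in> q_comp (i - n)"] by (simp add: gr_shift_def mcomp_eq comp Int_def)
  qed (simp_all add: gr_shift_def cl_eq_iff madd_cl mact_cl mzero_eq
      glat_lat_shift distrib_left right_diff_distrib mult.assoc)
qed

section \<open>Graded epimorphisms from a lattice onto a quotient of lattices\<close>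

lemma gr_homD:
  assumes "f \<in> gr_hom M N"
  shows "f \<in> mcarrier M \<rightarrow>\<^sub>E mcarrier N"
    "m \<in> mcarrier M \<Longrightarrow> m' \<in> mcarrier M \<Longrightarrow> f (madd M m m') = madd N (f m) (f m')"
    "m \<in> mcarrier M \<Longrightarrow> f (mact M m (A_class p)) = mact N (f m) (A_class p)"
    "m \<in> mcomp M i \<Longrightarrow> f m \<in> mcomp N i"
  using assms by (auto simp: gr_hom_def image_subset_iff)

lemma q_mod_simps [simp]:
  "mcarrier (q_mod P) = P" "mcomp (q_mod P) i = P \<inter> q_comp i" "madd (q_mod P) = (+)"
  "mzero (q_mod P) = 0" "mact (q_mod P) q (A_class p) = q * q_eval p"
  by (simp_all add: q_mod_def A_emb_class)

context lattice_quotient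
begin

text \<open>A graded homomorphism is determined in degree \<open>i\<close> by the image \<open>a\<^sub>i g\<^sub>i x\<^sup>i\<close> of \<open>p\<^sub>i x\<^sup>i\<close>, since
  right multiplication by polynomials in \<open>z\<close> reaches the whole component.\<close>

lemma hom_degreewise:
  assumes p: "A_stable p" and f: "f \<in> gr_hom (q_mod (glat p)) M"
  obtains g where "\<And>i u. f (qmono (to_fract (p i * u)) i) = cl (qmono (to_fract (a i * g i * u)) i)"
proof -
  have "\<exists>g. \<forall>u. f (qmono (to_fract (p i * u)) i) = cl (qmono (to_fract (a i * g * u)) i)" for i
  proof -
    have gen: "qmono (to_fract (p i)) i \<in> glat p" by (simp add: qmono_in_glat)
    then have "f (qmono (to_fract (p i)) i) \<in> mcomp M i"
      by (intro gr_homD(4)[OF f]) (simp add: q_comp_def)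
    then obtain q where q: "q \<in> glat a" "q \<in> q_comp i" "f (qmono (to_fract (p i)) i) = cl q"
      by (auto simp: mcomp_eq)
    obtain v where v: "\<forall>i. qlook q i = to_fract (a i * v i)" using q(1) by (rule glatE)
    have q': "q = qmono (to_fract (a i * v i)) i"
      by (rule qgr_eqI) (use q(2) v in \<open>auto simp: q_comp_iff\<close>)
    have "f (qmono (to_fract (p i * u)) i) = cl (qmono (to_fract (a i * v i * u)) i)" for u
    proof -
      let ?r = "free_z (pcompose u [:of_int (- i), 1:])"
      have r: "qmono (to_fract w) i * q_eval ?r = qmono (to_fract (w * u)) i" for w
        using pcompose_shift_inverse[of u i]
        by (simp add: q_eval_free_z qcoef_def qmono_mult zshift_to_fract)
      have "f (qmono (to_fract (p i * u)) i) = f (mact (q_mod (glat p)) (qmono (to_fract (p i)) i) (A_class ?r))"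
        by (simp only: q_mod_simps r)
      also have "\<dots> = mact M (cl q) (A_class ?r)"
        using gr_homD(3)[OF f, of "qmono (to_fract (p i)) i" ?r] gen q(3)
        by (simp del: q_eval_free_z)
      also have "\<dots> = cl (qmono (to_fract (a i * v i * u)) i)"
        unfolding mact_cl[OF q(1)] unfolding q' r ..
      finally show ?thesis .
    qed
    then show ?thesis by blast
  qed
  then show ?thesis using that by metis
qed

lemma hom_expand:
  assumes f: "f \<in> gr_hom (q_mod (glat p)) M"
    and g: "\<And>i u. f (qmono (to_fract (p i * u)) i) = cl (qmono (to_fract (a i * g i * u)) i)"
    and q: "\<forall>i. qlook q i = to_fract (p i * u i)"
  shows "f q = cl (\<Sum>i | qlook q i \<noteq> 0. qmono (to_fract (a i * g i * u i)) i)"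
proof -
  have lat: "qmono (to_fract (p i * u i)) i \<in> glat p" "qmono (to_fract (a i * g i * u i)) i \<in> glat a" for i
    by (simp_all add: qmono_in_glat mult.assoc del: to_fract_mult)
  have f0: "f 0 = cl 0" using g[of _ 0] by simp
  have "f (\<Sum>i\<in>F. qmono (to_fract (p i * u i)) i) = cl (\<Sum>i\<in>F. qmono (to_fract (a i * g i * u i)) i)"
    if "finite F" for F
    using that
  proof (induction F rule: finite_induct)
    case (insert i F)
    have "f (qmono (to_fract (p i * u i)) i + (\<Sum>i\<in>F. qmono (to_fract (p i * u i)) i))
        = madd M (f (qmono (to_fract (p i * u i)) i)) (f (\<Sum>i\<in>F. qmono (to_fract (p i * u i)) i))"
      using gr_homD(2)[OF f] lat glat_sum[of F, OF lat(1)] by (simp del: to_fract_mult)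
    then show ?case
      using insert lat glat_sum[of F, OF lat(2)] by (simp add: g madd_cl del: to_fract_mult)
  qed (simp add: f0)
  from this[OF finite_qlook[of q]] show ?thesis
    using qgr_expand[of q] q by simp
qed

text \<open>The kernel is independent of the epimorphism. In degree \<open>i\<close> surjectivity makes the polynomial
  \<open>g\<^sub>i\<close> of \<open>hom_degreewise\<close> invertible modulo \<open>e\<^sub>i\<close>, so that \<open>p\<^sub>i u x\<^sup>i\<close> is killed iff \<open>e\<^sub>i\<close>
  divides \<open>u\<close>.\<close>

lemma epi_kernel:
  assumes p: "A_stable p" and f: "f \<in> gr_epi (q_mod (glat p)) M"
    and d: "\<And>i. d i = a i * e i" and nz: "\<And>i. a i \<noteq> 0" "\<And>i. p i \<noteq> 0"
  shows "gr_ker (q_mod (glat p)) M f = glat (\<lambda>i. p i * e i)"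
proof -
  have hom: "f \<in> gr_hom (q_mod (glat p)) M" and surj: "f ` glat p = mcarrier M"
    using f by (auto simp: gr_epi_def)
  obtain g where g: "\<And>i u. f (qmono (to_fract (p i * u)) i) = cl (qmono (to_fract (a i * g i * u)) i)"
    using hom_degreewise[OF p hom] by blast
  have look: "qlook (\<Sum>i | qlook q i \<noteq> 0. qmono (to_fract (a i * g i * u i)) i) j
      = to_fract (a j * (g j * u j))" if u: "\<forall>i. qlook q i = to_fract (p i * u i)" for q u j
  proof -
    have "qlook (\<Sum>i | qlook q i \<noteq> 0. qmono (to_fract (a i * g i * u i)) i) j
        = (if qlook q j \<noteq> 0 then to_fract (a j * g j * u j) else 0)"
      by (simp only: qlook_sum qlook_simps sum.delta' finite_qlook mem_Collect_eq)
    then show ?thesis using u nz(2) by (auto simp: mult.assoc)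
  qed
  have sum_in: "(\<Sum>i | qlook q i \<noteq> 0. qmono (to_fract (a i * g i * u i)) i) \<in> glat a" for q u
    by (intro glat_sum) (simp add: qmono_in_glat mult.assoc del: to_fract_mult)
  have inv: "\<exists>u. e j dvd g j * u - 1" for j
  proof -
    have aj: "qmono (to_fract (a j)) j \<in> glat a" by (simp add: qmono_in_glat)
    then have "cl (qmono (to_fract (a j)) j) \<in> f ` glat p" by (simp add: surj carrier_eq)
    then obtain q where q: "q \<in> glat p" "cl (qmono (to_fract (a j)) j) = f q" by auto
    obtain u where u: "\<forall>i. qlook q i = to_fract (p i * u i)" using q(1) by (rule glatE)
    have "cl (\<Sum>i | qlook q i \<noteq> 0. qmono (to_fract (a i * g i * u i)) i) = cl (qmono (to_fract (a j)) j)"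
      using q(2) hom_expand[OF hom g u] by simp
    then have "(\<Sum>i | qlook q i \<noteq> 0. qmono (to_fract (a i * g i * u i)) i)
        - qmono (to_fract (a j)) j \<in> glat d"
      by (simp only: cl_eq_iff[OF sum_in aj])
    then obtain w where "\<forall>i. qlook ((\<Sum>i | qlook q i \<noteq> 0. qmono (to_fract (a i * g i * u i)) i)
        - qmono (to_fract (a j)) j) i = to_fract (d i * w i)" by (rule glatE)
    then have "to_fract (a j * (g j * u j)) - to_fract (a j) = to_fract (d j * w j)"
      unfolding qlook_simps look[OF u] by (metis (full_types))
    then have "a j * (g j * u j) - a j = d j * w j"
      by (simp only: to_fract_eq_iff flip: to_fract_diff)
    then have "a j * (g j * u j - 1) = a j * (e j * w j)"
      unfolding d by (simp add: right_diff_distrib mult.assoc)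
    then show ?thesis using nz(1)[of j] by (auto simp: dvd_def)
  qed
  have unit: "e j dvd g j * v \<longleftrightarrow> e j dvd v" for j v
  proof
    obtain u where u: "e j dvd g j * u - 1" using inv by blast
    assume "e j dvd g j * v"
    then have "e j dvd (g j * v) * u - (g j * u - 1) * v"
      by (rule dvd_diff[OF dvd_mult2 dvd_mult2[OF u]])
    then show "e j dvd v" by (simp add: algebra_simps)
  qed simp
  have "f q = mzero M \<longleftrightarrow> q \<in> glat (\<lambda>i. p i * e i)" if q: "q \<in> glat p" for q
  proof -
    obtain u where u: "\<forall>i. qlook q i = to_fract (p i * u i)" using q by (rule glatE)
    have "f q = mzero M \<longleftrightarrow> (\<Sum>i | qlook q i \<noteq> 0. qmono (to_fract (a i * g i * u i)) i) \<in> glat d"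
      unfolding hom_expand[OF hom g u] mzero_eq by (subst cl_eq_iff) (simp_all add: sum_in del: to_fract_mult)
    also have "\<dots> \<longleftrightarrow> (\<forall>j. \<exists>w. a j * (g j * u j) = a j * (e j * w))"
      unfolding glat_def mem_Collect_eq look[OF u] d to_fract_eq_iff by (simp only: mult.assoc)
    also have "\<dots> \<longleftrightarrow> (\<forall>j. e j dvd u j)"
      using nz(1) unit by (simp add: dvd_def)
    also have "\<dots> \<longleftrightarrow> (\<forall>j. \<exists>w. p j * u j = p j * (e j * w))"
      using nz(2) by (simp add: dvd_def)
    also have "\<dots> \<longleftrightarrow> q \<in> glat (\<lambda>i. p i * e i)"
      unfolding glat_def mem_Collect_eq using u by (simp only: to_fract_eq_iff mult.assoc)
    finally show ?thesis .
  qed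
  moreover have "glat (\<lambda>i. p i * e i) \<subseteq> glat p" by (rule glat_mono) simp
  ultimately show ?thesis unfolding gr_ker_def by auto
qed

text \<open>The obstruction to surjecting onto \<open>X\<langle>n\<rangle>\<close>, which vanishes in degree \<open>n + 1\<close> but not in degree
  \<open>n\<close>. If \<open>M\<close> vanishes in degree \<open>n + 1\<close>, then \<open>p\<^sub>n\<^sub>+\<^sub>1 x\<^sup>n\<^sup>+\<^sup>1\<close> is killed, and so is its product
  with \<open>y\<close>. If \<open>p\<^sub>n = p\<^sub>n\<^sub>+\<^sub>1 (z + n)\<^sup>2\<close>, that product is the generator \<open>p\<^sub>n x\<^sup>n\<close> of the component
  of degree \<open>n\<close>, so that \<open>M\<close> vanishes there as well.\<close>

lemma epi_descent:
  assumes p: "A_stable p" and f: "f \<in> gr_epi (q_mod (glat p)) M"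
    and d: "\<And>i. d i = a i * e i" and nz: "\<And>i. a i \<noteq> 0" "\<And>i. p i \<noteq> 0"
    and n: "p n = p (n + 1) * lin n ^ 2" "e (n + 1) = 1"
  shows "e n dvd 1"
proof -
  have hom: "f \<in> gr_hom (q_mod (glat p)) M" using f by (simp add: gr_epi_def)
  have ker: "q \<in> glat (\<lambda>i. p i * e i) \<longleftrightarrow> q \<in> glat p \<and> f q = cl 0" for q
    using epi_kernel[OF p f d nz] by (auto simp: gr_ker_def mzero_eq)
  let ?q = "qmono (to_fract (p (n + 1))) (n + 1)"
  have "?q \<in> glat (\<lambda>i. p i * e i)" by (simp add: qmono_in_glat n(2))
  then have q: "?q \<in> glat p" "f ?q = cl 0" by (simp_all add: ker)
  have qy: "?q * q_eval (fgen GY) = qmono (to_fract (p n)) n"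
    using lin_shift[of "- 1" "n + 1", where 'a = 'k]
    unfolding q_eval_fgen qgen_Y n(1)
    by (simp add: qmono_mult zshift_to_fract zshift_mult power2_eq_square)
  have "f (?q * q_eval (fgen GY)) = cl 0"
    using gr_homD(3)[OF hom, of ?q "fgen GY"] q mact_cl[of 0 "fgen GY"] by (simp del: q_eval_fgen)
  then have "qmono (to_fract (p n)) n \<in> glat (\<lambda>i. p i * e i)"
    unfolding ker qy by (simp add: qmono_in_glat)
  then show ?thesis using nz(2)[of n] by (simp add: qmono_in_glat)
qed

text \<open>The epimorphism is left multiplication by \<open>\<phi>\<close>; the hypothesis \<open>unit\<close> makes it surjective in
  each degree.\<close>

lemma epi_exists:
  assumes p: "A_stable p" and d: "\<And>i. d i = a i * e i" and nz: "\<And>i. a i \<noteq> 0"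
    and \<phi>: "\<And>i. \<phi> * to_fract (p i) = to_fract (a i * g i)"
    and unit: "\<And>i. \<exists>w. e i dvd g i * w - 1"
  shows "gr_epi (q_mod (glat p)) M \<noteq> {}"
proof -
  define f where "f = restrict (\<lambda>q. cl (qmono \<phi> 0 * q)) (glat p)"
  have look: "qlook (qmono \<phi> 0 * q) j = to_fract (a j * (g j * u j))"
    if "\<forall>i. qlook q i = to_fract (p i * u i)" for q u j
    using that \<phi>[of j] by (simp add: qlook_mono_mult flip: mult.assoc)
  have in_a: "qmono \<phi> 0 * q \<in> glat a" if q: "q \<in> glat p" for q
  proof -
    obtain u where u: "\<forall>i. qlook q i = to_fract (p i * u i)" using q by (rule glatE)
    show ?thesis by (rule glatI[OF look[OF u]])
  qed
  have "f \<in> gr_hom (q_mod (glat p)) M"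
    unfolding gr_hom_def mem_Collect_eq
  proof (intro conjI ballI allI)
    show "f \<in> mcarrier (q_mod (glat p)) \<rightarrow>\<^sub>E mcarrier M"
      using in_a by (auto simp: f_def carrier_eq)
  next
    fix q q' assume "q \<in> mcarrier (q_mod (glat p))" "q' \<in> mcarrier (q_mod (glat p))"
    then show "f (madd (q_mod (glat p)) q q') = madd M (f q) (f q')"
      by (simp add: f_def glat_add in_a madd_cl distrib_left)
  next
    fix q :: "'k qgr" and r :: "'k free_alg set"
    assume "q \<in> mcarrier (q_mod (glat p))" "r \<in> carrier algA"
    then show "f (mact (q_mod (glat p)) q r) = mact M (f q) r"
      by (auto simp: f_def glat_mult_q_eval[OF p] in_a mact_cl mult.assoc)
  next
    fix i
    show "f ` mcomp (q_mod (glat p)) i \<subseteq> mcomp M i"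
      using in_a by (auto simp: f_def mcomp_eq q_comp_iff qlook_mono_mult intro!: imageI)
  qed
  moreover have "mcarrier M \<subseteq> f ` glat p"
  proof
    fix m assume "m \<in> mcarrier M"
    then obtain r where r: "m = cl r" "r \<in> glat a" by (auto simp: carrier_eq)
    obtain v where v: "\<forall>i. qlook r i = to_fract (a i * v i)" using r(2) by (rule glatE)
    obtain w where w: "\<And>i. e i dvd g i * w i - 1" using unit by metis
    define q where "q = (\<Sum>i | qlook r i \<noteq> 0. qmono (to_fract (p i * (v i * w i))) i)"
    have q: "\<forall>i. qlook q i = to_fract (p i * (v i * w i))"
    proof
      fix i
      have "qlook q i = (if qlook r i \<noteq> 0 then to_fract (p i * (v i * w i)) else 0)"
        unfolding q_def
        by (simp only: qlook_sum qlook_simps sum.delta' finite_qlook mem_Collect_eq)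
      then show "qlook q i = to_fract (p i * (v i * w i))" using v nz by auto
    qed
    have q_in: "q \<in> glat p" by (rule glatI) (rule spec[OF q])
    have "qmono \<phi> 0 * q - r \<in> glat d"
    proof -
      obtain x where x: "\<And>i. g i * w i - 1 = e i * x i" using w unfolding dvd_def by metis
      have "qlook (qmono \<phi> 0 * q - r) i = to_fract (d i * (x i * v i))" for i
      proof -
        have "qlook (qmono \<phi> 0 * q - r) i = to_fract (a i * (g i * (v i * w i)) - a i * v i)"
          unfolding qlook_simps look[OF q] using v by simp
        also have "a i * (g i * (v i * w i)) - a i * v i = a i * v i * (g i * w i - 1)"
          by (simp add: algebra_simps)
        also have "\<dots> = d i * (x i * v i)" unfolding x d by (simp add: mult_ac)
        finally show ?thesis .
      qed
      then show ?thesis by (rule glatI)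
    qed
    then have "f q = m"
      using q_in r(1) cl_eq_iff[OF in_a[OF q_in] r(2)] by (simp add: f_def)
    then show "m \<in> f ` glat p" using q_in by blast
  qed
  ultimately have "f \<in> gr_epi (q_mod (glat p)) M"
    using in_a unfolding gr_epi_def by (auto simp: f_def carrier_eq)
  then show ?thesis by blast
qed

end

section \<open>The modules \<open>X\<close>, \<open>Y\<close>, \<open>A/xA\<close> and \<open>A/yA\<close>\<close>

text \<open>The lattices \<open>x\<^sup>n (xA + z\<^sup>e A)\<close> and \<open>x\<^sup>n\<^sup>+\<^sup>1 (yA + (z - 1)\<^sup>e A)\<close> for \<open>e = 1, 2\<close>. Since
  \<open>z\<^sup>2 = xy\<close> and \<open>(z - 1)\<^sup>2 = yx\<close>, the case \<open>e = 2\<close> is that of \<open>xA\<close> and \<open>yA\<close>, and the case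
  \<open>e = 1\<close> gives \<open>X\<close> and \<open>Y\<close>.\<close>

definition lat_x :: "int \<Rightarrow> nat \<Rightarrow> int \<Rightarrow> 'k::field poly" where
  "lat_x n e i = sq {i..<n} * (if i \<le> n then lin n ^ e else 1)"

definition lat_y :: "int \<Rightarrow> nat \<Rightarrow> int \<Rightarrow> 'k::field poly" where
  "lat_y n e i = sq {i..<n + 1} * (if n < i then lin n ^ e else 1)"

lemma A_stable_lat_x:
  assumes "e \<le> 2"
  shows "A_stable (lat_x n e)"
  unfolding A_stable_def
proof
  fix i
  consider "i < n" | "i = n" | "n < i" by linarith
  then show "lat_x n e (i + 1) dvd lat_x n e i \<and> lat_x n e i dvd lat_x n e (i + 1) * lin i ^ 2"
  proof cases
    case 1
    then have *: "lat_x n e i = lat_x n e (i + 1) * lin i ^ 2"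
      by (simp add: lat_x_def sq_step[of i n] mult_ac)
    show ?thesis unfolding * by simp
  qed (use assms in \<open>auto simp: lat_x_def le_imp_power_dvd\<close>)
qed

lemma A_stable_lat_y:
  assumes "e \<le> 2"
  shows "A_stable (lat_y n e)"
  unfolding A_stable_def
proof
  fix i
  consider "i < n" | "i = n" | "n < i" by linarith
  then show "lat_y n e (i + 1) dvd lat_y n e i \<and> lat_y n e i dvd lat_y n e (i + 1) * lin i ^ 2"
  proof cases
    case 1
    then have *: "lat_y n e i = lat_y n e (i + 1) * lin i ^ 2"
      by (simp add: lat_y_def sq_step[of i "n + 1"] mult_ac)
    show ?thesis unfolding * by simp
  next
    case 2
    then show ?thesis using assms
      by (simp add: lat_y_def sq_step[of n "n + 1"] le_imp_power_dvd)
  qed (auto simp: lat_y_def)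
qed

lemma lat_shift_sq: "lat_shift n (\<lambda>i. sq {i..<m}) = (\<lambda>i. sq {i..<m + n})"
proof
  fix i
  have "lat_shift n (\<lambda>i. sq {i..<m}) i = (\<Prod>j\<in>{i - n..<m}. lin (j + n) ^ 2)"
    by (simp add: lat_shift_def sq_def pcompose_prod power2_eq_square pcompose_mult lin_shift add.commute)
  also have "\<dots> = sq {i..<m + n}"
    unfolding sq_def by (rule prod.reindex_bij_witness[of _ "\<lambda>j. j - n" "\<lambda>j. j + n"]) auto
  finally show "lat_shift n (\<lambda>i. sq {i..<m}) i = sq {i..<m + n}" .
qed

lemma pcompose_power: "pcompose (p ^ e) q = pcompose p q ^ e"
  by (induction e) (simp_all add: pcompose_1 pcompose_mult)

lemma lat_shift_x: "lat_shift n (lat_x 0 e) = lat_x n e"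
proof
  fix i
  have "pcompose (sq {i - n..<0}) [:of_int n, 1:] = (sq {i..<n} :: 'a poly)"
    using fun_cong[OF lat_shift_sq[of n 0], of i] by (simp add: lat_shift_def)
  then show "lat_shift n (lat_x 0 e) i = (lat_x n e i :: 'a poly)"
    using lin_shift[of 0 n, where 'a = 'a]
    by (simp add: lat_shift_def lat_x_def pcompose_mult pcompose_power pcompose_1)
qed

lemma lat_shift_y: "lat_shift (n + 1) (lat_y (- 1) e) = lat_y n e"
proof
  fix i
  have "pcompose (sq {i - (n + 1)..<0}) [:of_int (n + 1), 1:] = (sq {i..<n + 1} :: 'a poly)"
    using fun_cong[OF lat_shift_sq[of "n + 1" 0], of i] by (simp add: lat_shift_def)
  then show "lat_shift (n + 1) (lat_y (- 1) e) i = (lat_y n e i :: 'a poly)"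
    using lin_shift[of "- 1" "n + 1", where 'a = 'a]
    by (simp add: lat_shift_def lat_y_def pcompose_mult pcompose_power pcompose_1)
qed

lemma q_eval_X_A_word: "q_eval (fgen GX * A_word (i - 1)) = qmono (to_fract (sq {i..<0})) i" if "0 < i"
  using that by (simp add: q_eval_mult q_eval_A_word qmono_mult)

lemma zshift_lin: "zshift i (to_fract (lin j)) = to_fract (lin (i + j))"
  by (simp only: zshift_to_fract lin_shift)

text \<open>In degrees \<open>i > 0\<close> the right ideal is all of \<open>A\<close>, since \<open>x\<^sup>i \<in> xA\<close>. In degrees \<open>i \<le> 0\<close> it is
  generated by \<open>z\<close> times the word of degree \<open>i\<close> if \<open>e = 1\<close>, and by \<open>xy = z\<^sup>2\<close> times it if
  \<open>e = 2\<close>.\<close>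

lemma A_mod_x_quotient:
  fixes T :: "'k::field free_alg set"
  assumes "T = (if e = 1 then {fgen GX, fgen GZ} else {fgen GX})" "e \<in> {1, 2}"
  shows "\<exists>cl. lattice_quotient (gr_shift (A_mod (A_class ` T)) n) (\<lambda>i. sq {i..<n}) (lat_x n e) cl"
proof -
  have "\<exists>cl. lattice_quotient (A_mod (A_class ` T)) (\<lambda>i. sq {i..<0}) (lat_x 0 e) cl"
  proof (rule lattice_quotient_A_mod)
    show "A_stable (lat_x 0 e)" using assms by (auto intro: A_stable_lat_x)
    have "q_eval (fgen GX) \<in> glat (lat_x 0 e)" "q_eval (fgen GZ) \<in> glat (lat_x 0 1)"
      by (simp_all add: qmono_in_glat[of 1, simplified] qcoef_in_glat lat_x_def lin_def)
    then show "q_eval s \<in> glat (lat_x 0 e)" if "s \<in> T" for s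
      using that assms by (auto split: if_splits)
    fix i
    show "\<exists>s\<in>T. \<exists>t. q_eval (s * t) = qmono (to_fract (lat_x 0 e i)) i"
    proof (cases "0 < i")
      case True
      then have "q_eval (fgen GX * A_word (i - 1)) = qmono (to_fract (lat_x 0 e i)) i"
        by (simp add: q_eval_X_A_word lat_x_def)
      then show ?thesis using assms(1) by (auto split: if_splits)
    next
      case False
      show ?thesis
      proof (cases "e = 1")
        case True
        have "q_eval (fgen GZ * A_word i) = qmono (to_fract (lat_x 0 e i)) i"
          using False True unfolding q_eval_mult q_eval_fgen qgen_Z q_eval_A_word
          by (simp add: qcoef_def qmono_mult lat_x_def mult.commute)
        then show ?thesis using assms(1) True by (intro bexI[where x = "fgen GZ"]) auto
      next
        case e: False
        have "q_eval (fgen GX * (fgen GY * A_word i) :: 'k free_alg) = qmono (to_fract (lat_x 0 e i)) i"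
          using False e assms(2) zshift_lin[of 1 "- 1", where 'a = 'k]
          unfolding q_eval_mult q_eval_fgen qgen_Y q_eval_A_word
          by (simp add: qmono_mult lat_x_def zshift_mult power2_eq_square mult_ac zshift_zshift)
        then show ?thesis using assms(1) e by auto
      qed
    qed
  qed
  then obtain cl where "lattice_quotient (A_mod (A_class ` T)) (\<lambda>i. sq {i..<0}) (lat_x 0 e) cl" by blast
  from lattice_quotient_shift[OF this, of n] show ?thesis
    unfolding lat_shift_x lat_shift_sq by auto
qed

lemma A_mod_y_quotient:
  fixes T :: "'k::field free_alg set"
  assumes "T = (if e = 1 then {fgen GY, fgen GZ - 1} else {fgen GY})" "e \<in> {1, 2}"
  shows "\<exists>cl. lattice_quotient (gr_shift (A_mod (A_class ` T)) (n + 1)) (\<lambda>i. sq {i..<n + 1}) (lat_y n e) cl"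
proof -
  have z1: "q_eval (fgen GZ - 1) = qcoef (lin (- 1))"
  proof -
    have "q_eval (fgen GZ - 1) = q_eval (free_z [:- 1, 1:])"
      by (simp add: free_z_linear single_uminus single_nil)
    then show ?thesis by (simp add: lin_def)
  qed
  have "\<exists>cl. lattice_quotient (A_mod (A_class ` T)) (\<lambda>i. sq {i..<0}) (lat_y (- 1) e) cl"
  proof (rule lattice_quotient_A_mod)
    show "A_stable (lat_y (- 1) e)" using assms by (auto intro: A_stable_lat_y)
    have "sq {- 1..<0} = (lin (- 1) ^ 2 :: 'k poly)" using sq_step[of "- 1" 0] by simp
    then have "q_eval (fgen GY :: 'k free_alg) \<in> glat (lat_y (- 1) e)"
      "q_eval (fgen GZ - 1 :: 'k free_alg) \<in> glat (lat_y (- 1) 1)"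
      unfolding z1 q_eval_fgen qgen_Y by (simp_all only: qmono_in_glat qcoef_in_glat) (simp_all add: lat_y_def)
    then show "q_eval s \<in> glat (lat_y (- 1) e)" if "s \<in> T" for s
      using that assms by (auto split: if_splits)
    fix i
    show "\<exists>s\<in>T. \<exists>t. q_eval (s * t) = qmono (to_fract (lat_y (- 1) e i)) i"
    proof (cases "i < 0")
      case True
      then have "A_word i = fgen GY * (A_word (i + 1) :: 'k free_alg)"
        using A_word_int(2)[where 'k = 'k, of "Suc (nat (- i - 1))"] A_word_int(2)[where 'k = 'k, of "nat (- i - 1)"]
        by (simp add: add.commute)
      moreover have "lat_y (- 1) e i = (sq {i..<0} :: 'k poly)" using True by (simp add: lat_y_def)
      ultimately have "q_eval (fgen GY * A_word (i + 1) :: 'k free_alg) = qmono (to_fract (lat_y (- 1) e i)) i"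
        using q_eval_A_word[of i, where 'a = 'k] by (simp del: to_fract_mult q_eval_fgen)
      then show ?thesis using assms(1) by (auto split: if_splits)
    next
      case False
      show ?thesis
      proof (cases "e = 1")
        case True
        have "q_eval ((fgen GZ - 1) * A_word i) = qmono (to_fract (lat_y (- 1) e i)) i"
          using False True
          by (simp add: q_eval_mult z1 q_eval_A_word qcoef_def qmono_mult lat_y_def)
        then show ?thesis using assms(1) True by auto
      next
        case e: False
        have "q_eval (fgen GY * (fgen GX * A_word i)) = qmono (to_fract (lat_y (- 1) e i)) i"
          using False e assms(2)
          unfolding q_eval_mult q_eval_fgen qgen_Y q_eval_A_word
          by (simp add: qmono_mult lat_y_def)
        then show ?thesis using assms(1) e by auto
      qed
    qed
  qed
  then obtain cl where "lattice_quotient (A_mod (A_class ` T)) (\<lambda>i. sq {i..<0}) (lat_y (- 1) e) cl" by blast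
  from lattice_quotient_shift[OF this, of "n + 1"] show ?thesis
    unfolding lat_shift_y lat_shift_sq by auto
qed

section \<open>The action of \<open>\<iota>\<^sub>n\<close> on lattices\<close>

text \<open>In characteristic zero \<open>z + n\<close> is coprime to the other factors \<open>z + j\<close>.\<close>

lemma sq_coprime_lin:
  assumes "n \<notin> F" "e \<le> 2"
  shows "\<exists>w. lin n ^ e dvd sq F * w - (1 :: 'k::field_char_0 poly)"
proof -
  let ?c = "poly (sq F :: 'k poly) (- of_int n)"
  have "?c \<noteq> 0"
    using assms(1) by (cases "finite F") (auto simp: sq_def poly_prod lin_def simp flip: of_int_minus of_int_add)
  have "[:of_int n, 1:] dvd sq F - [:?c:]"
    using poly_eq_0_iff_dvd[of "sq F - [:?c:]" "- of_int n"] by simp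
  then obtain t where t: "sq F = lin n * t + [:?c:]"
    by (auto simp: dvd_def lin_def diff_eq_eq)
  \<comment> \<open>The inverse comes from \<open>(c + l t) (c - l t) = c\<^sup>2 - l\<^sup>2 t\<^sup>2\<close> with \<open>l = z + n\<close>.\<close>
  have "sq F * (([:?c:] - lin n * t) * [:1 / ?c ^ 2:]) - 1
      = [:?c:] * [:?c:] * [:1 / ?c ^ 2:] - 1 - lin n ^ 2 * (t ^ 2 * [:1 / ?c ^ 2:])"
    by (subst t) (simp only: algebra_simps power2_eq_square)
  also have "[:?c:] * [:?c:] * [:1 / ?c ^ 2:] - 1 = 0"
    using \<open>?c \<noteq> 0\<close> by (simp add: power2_eq_square one_pCons)
  finally have *: "sq F * (([:?c:] - lin n * t) * [:1 / ?c ^ 2:]) - 1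
      = 0 - lin n ^ 2 * (t ^ 2 * [:1 / ?c ^ 2:])" .
  have "lin n ^ 2 dvd sq F * (([:?c:] - lin n * t) * [:1 / ?c ^ 2:]) - 1"
    unfolding * by (simp only: diff_0 dvd_minus_iff dvd_triv_left)
  then show ?thesis using le_imp_power_dvd[OF assms(2), of "lin n"] dvd_trans by blast
qed

text \<open>The types of the lattices obtained from \<open>A\<close>: they differ from that of \<open>A\<close> in finitely many
  places.\<close>

definition lat_type :: "int set \<Rightarrow> bool" where
  "lat_type T \<longleftrightarrow> finite (T - {0..}) \<and> finite ({0..} - T)"

lemma lat_type_finite:
  assumes "lat_type T"
  shows "finite ({i..} - T)" "finite (T \<inter> {..<n})"
proof -
  have "{i..} - T \<subseteq> ({0..} - T) \<union> {i..<0}" "T \<inter> {..<n} \<subseteq> (T - {0..}) \<union> {0..<n}" by auto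
  then show "finite ({i..} - T)" "finite (T \<inter> {..<n})"
    using assms by (auto simp: lat_type_def elim!: finite_subset)
qed

lemma lat_type_update: "lat_type T \<Longrightarrow> lat_type (insert n T)" "lat_type T \<Longrightarrow> lat_type (T - {n})"
proof -
  assume T: "lat_type T"
  have "insert n T - {0..} \<subseteq> insert n (T - {0..})" "{0..} - insert n T \<subseteq> {0..} - T"
    "T - {n} - {0..} \<subseteq> T - {0..}" "{0..} - (T - {n}) \<subseteq> insert n ({0..} - T)" by auto
  then show "lat_type (insert n T)" "lat_type (T - {n})"
    using T by (auto simp: lat_type_def elim!: finite_subset)
qed

text \<open>The lattice of type \<open>T\<close> with common factor \<open>g\<close>. If \<open>{i..} - T\<close> is finite, then
  \<open>lat g T i\<close> is \<open>lat g T (i + 1)\<close> if \<open>i \<in> T\<close>, and \<open>(z + i)\<^sup>2\<close> times it otherwise.\<close>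

definition lat :: "'k::field poly \<Rightarrow> int set \<Rightarrow> int \<Rightarrow> 'k poly" where
  "lat g T i = g * sq ({i..} - T)"

lemma lat_nonzero [simp]: "g \<noteq> 0 \<Longrightarrow> lat g T i \<noteq> 0"
  by (simp add: lat_def)

lemma lat_step:
  fixes g :: "'a::field poly"
  assumes "lat_type T"
  shows "lat g T i = (if i \<in> T then lat g T (i + 1) else lat g T (i + 1) * lin i ^ 2)"
proof -
  have split: "{i..} = insert i {i + 1..}" by (auto simp: order_le_less)
  show ?thesis
  proof (cases "i \<in> T")
    case True
    then show ?thesis by (simp add: lat_def split)
  next
    case False
    then have "sq ({i..} - T) = lin i ^ 2 * (sq ({i + 1..} - T) :: 'a poly)"
      using lat_type_finite(1)[OF assms, of "i + 1"] by (simp add: split sq_insert insert_Diff_if)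
    then show ?thesis using False by (simp add: lat_def)
  qed
qed

lemma A_stable_lat: "lat_type T \<Longrightarrow> A_stable (lat g T)"
  unfolding A_stable_def by (subst (2 3) lat_step) simp_all

text \<open>Existence of the epimorphisms onto the quotients of \<open>A\<langle>n\<rangle>\<close> and \<open>A\<langle>n + 1\<rangle>\<close> from the section
  before. The parameter \<open>m\<close> covers both cases: \<open>x\<^sup>m A\<close> is generated by \<open>sq {i..<m} x\<^sup>i\<close> in
  degree \<open>i\<close>. The quotient vanishes in the degrees where \<open>P\<close> fails.\<close>

lemma epi_lat:
  assumes "lattice_quotient M (\<lambda>i. sq {i..<m}) d cl"
    and d: "\<And>i. d i = sq {i..<m} * (if P i then lin n ^ e else 1)" "e \<le> 2"
    and T: "lat_type T" and g: "g \<noteq> (0 :: 'k::field_char_0 poly)"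
    and m: "m = n \<or> m = n + 1 \<and> n \<notin> T" and P: "\<And>i. P i \<Longrightarrow> n \<in> T \<or> n < i"
  shows "gr_epi (q_mod (glat (lat g T))) M \<noteq> {}"
proof -
  interpret lattice_quotient M "\<lambda>i. sq {i..<m}" d cl by fact
  \<comment> \<open>Multiplying \<open>p\<^sub>i\<close> by \<open>\<phi> = (\<Prod>\<^bsub>j \<in> T, j < n\<^esub> (z + j)\<^sup>2) / g\<close> gives \<open>sq (E i)\<close>. This is a multiple of
    \<open>sq {i..<m}\<close>, and \<open>z + n\<close> does not divide the quotient where \<open>P i\<close> holds.\<close>
  define E where "E i = ({i..} - T) \<union> (T \<inter> {..<n})" for i
  note fin = lat_type_finite[OF T]
  show ?thesis
  proof (rule epi_exists)
    show "A_stable (lat g T)" by (rule A_stable_lat[OF T])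
    show "to_fract (sq (T \<inter> {..<n})) / to_fract g * to_fract (lat g T i)
        = to_fract (sq {i..<m} * sq (E i - {i..<m}))" for i
    proof -
      have "{i..<m} \<subseteq> E i"
      proof
        fix x assume x: "x \<in> {i..<m}"
        have "x < n" if "x \<in> T" using m that x by (cases "x = n") auto
        then show "x \<in> E i" using x by (auto simp: E_def)
      qed
      moreover have "finite (E i)" using fin by (simp add: E_def)
      ultimately have "sq {i..<m} * sq (E i - {i..<m}) = (sq (E i) :: 'k poly)" by (simp add: sq_diff)
      also have "\<dots> = sq ({i..} - T) * sq (T \<inter> {..<n})"
        unfolding E_def by (rule sq_union) (use fin in auto)
      finally show ?thesis using g by (simp add: lat_def)
    qed
    show "\<exists>w. (if P i then lin n ^ e else 1) dvd sq (E i - {i..<m}) * w - (1 :: 'k poly)" for i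
    proof (cases "P i")
      case True
      then have "n \<notin> E i - {i..<m}" using P[of i] m by (auto simp: E_def)
      from sq_coprime_lin[OF this d(2), where 'k = 'k] show ?thesis using True by simp
    qed simp
  qed (use d in auto)
qed

text \<open>The definite description in the definition of \<open>\<iota>\<^sub>n\<close> has a value because any two epimorphisms
  have the same kernel.\<close>

lemma iota_kernel:
  assumes "lattice_quotient M a d cl" and d: "\<And>i. d i = a i * e i" and nz: "\<And>i. a i \<noteq> 0"
    and p: "A_stable p" "\<And>i. p i \<noteq> 0" and epi: "gr_epi (q_mod (glat p)) M \<noteq> {}"
  shows "(THE K. \<exists>f\<in>gr_epi (q_mod (glat p)) M. K = gr_ker (q_mod (glat p)) M f) = glat (\<lambda>i. p i * e i)"
proof -
  interpret lattice_quotient M a d cl by fact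
  show ?thesis
    by (rule the_equality) (use epi epi_kernel[OF p(1) _ d nz p(2)] in auto)
qed

lemma gr_shift_gr_shift: "gr_shift (gr_shift M m) n = gr_shift M (m + n)"
  by (simp add: gr_shift_def diff_diff_eq add.commute)

text \<open>On types, \<open>\<iota>\<^sub>n\<close> is the toggling of \<open>n\<close>. If \<open>n \<in> T\<close>, passing to the kernel of the map onto
  \<open>(A/xA)\<langle>n\<rangle>\<close> multiplies \<open>p\<^sub>i\<close> by \<open>(z + n)\<^sup>2\<close> for \<open>i \<le> n\<close>, which makes \<open>p\<^sub>n\<close> and \<open>p\<^sub>n\<^sub>+\<^sub>1\<close> differ
  by that factor. If \<open>n \<notin> T\<close>, the kernel of the map onto \<open>(A/yA)\<langle>n + 1\<rangle>\<close> multiplies \<open>p\<^sub>i\<close> by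
  \<open>(z + n)\<^sup>2\<close> for \<open>i > n\<close>, which makes them equal.\<close>

lemma iota_lat:
  fixes g :: "'k::field_char_0 poly"
  assumes T: "lat_type T" and g: "g \<noteq> 0"
  shows "iota n (glat (lat g T)) =
    glat (if n \<in> T then lat g (T - {n}) else lat (g * lin n ^ 2) (insert n T))"
proof -
  note fin = lat_type_finite(1)[OF T]
  note stable = A_stable_lat[OF T, of g]
  obtain clX where X: "lattice_quotient (gr_shift modX n) (\<lambda>i. sq {i..<n}) (lat_x n 1 :: int \<Rightarrow> 'k poly) clX"
    using A_mod_x_quotient[of "{fgen GX :: 'k free_alg, fgen GZ}" 1 n] by (auto simp: modX_def)
  obtain clY where Y: "lattice_quotient (gr_shift modY n) (\<lambda>i. sq {i..<n + 1}) (lat_y n 1 :: int \<Rightarrow> 'k poly) clY"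
    using A_mod_y_quotient[of "{fgen GY :: 'k free_alg, fgen GZ - 1}" 1 n]
    by (auto simp: modY_def gr_shift_gr_shift add.commute)
  obtain cl2 where X2: "lattice_quotient (gr_shift (A_mod {A_class (fgen GX)}) n)
      (\<lambda>i. sq {i..<n}) (lat_x n 2 :: int \<Rightarrow> 'k poly) cl2"
    using A_mod_x_quotient[of "{fgen GX :: 'k free_alg}" 2 n] by auto
  obtain cl3 where Y2: "lattice_quotient (gr_shift (A_mod {A_class (fgen GY)}) (n + 1))
      (\<lambda>i. sq {i..<n + 1}) (lat_y n 2 :: int \<Rightarrow> 'k poly) cl3"
    using A_mod_y_quotient[of "{fgen GY :: 'k free_alg}" 2 n] by auto
  show ?thesis
  proof (cases "n \<in> T")
    case True
    have "gr_epi (q_mod (glat (lat g T))) (gr_shift modX n) \<noteq> {}"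
      by (rule epi_lat[OF X lat_x_def _ T g]) (use True in auto)
    moreover have "gr_epi (q_mod (glat (lat g T))) (gr_shift (A_mod {A_class (fgen GX)}) n) \<noteq> {}"
      by (rule epi_lat[OF X2 lat_x_def _ T g]) (use True in auto)
    ultimately have "iota n (glat (lat g T)) = glat (\<lambda>i. lat g T i * (if i \<le> n then lin n ^ 2 else 1))"
      unfolding iota_def Let_def
      using iota_kernel[OF X2 lat_x_def _ stable] g by simp
    moreover have "lat g T i * (if i \<le> n then lin n ^ 2 else 1) = lat g (T - {n}) i" for i
    proof -
      have "{i..} - (T - {n}) = (if i \<le> n then insert n ({i..} - T) else {i..} - T)" by auto
      then show ?thesis using True fin[of i] by (simp add: lat_def sq_insert mult_ac)
    qed
    ultimately show ?thesis using True by simp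
  next
    case False
    have "gr_epi (q_mod (glat (lat g T))) (gr_shift modX n) = {}"
    proof (rule ccontr)
      assume "gr_epi (q_mod (glat (lat g T))) (gr_shift modX n) \<noteq> {}"
      then obtain f where f: "f \<in> gr_epi (q_mod (glat (lat g T))) (gr_shift modX n)" by blast
      have "(if n \<le> n then lin n ^ 1 else 1) dvd (1 :: 'k poly)"
        by (rule lattice_quotient.epi_descent[OF X stable f lat_x_def])
           (use g False lat_step[OF T, of g n] in auto)
      then show False by (simp add: lin_def is_unit_poly_iff)
    qed
    moreover have "gr_epi (q_mod (glat (lat g T))) (gr_shift modY n) \<noteq> {}"
      by (rule epi_lat[OF Y lat_y_def _ T g]) (use False in auto)
    moreover have "gr_epi (q_mod (glat (lat g T))) (gr_shift (A_mod {A_class (fgen GY)}) (n + 1)) \<noteq> {}"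
      by (rule epi_lat[OF Y2 lat_y_def _ T g]) (use False in auto)
    ultimately have "iota n (glat (lat g T)) = glat (\<lambda>i. lat g T i * (if n < i then lin n ^ 2 else 1))"
      unfolding iota_def Let_def
      using iota_kernel[OF Y2 lat_y_def _ stable] g by simp
    moreover have "lat g T i * (if n < i then lin n ^ 2 else 1) = lat (g * lin n ^ 2) (insert n T) i" for i
    proof -
      have *: "{i..} - insert n T = ({i..} - T) - {n}" by auto
      show ?thesis
      proof (cases "n < i")
        case False
        then have "{i..} - T = insert n (({i..} - T) - {n})" using \<open>n \<notin> T\<close> by auto
        then have "sq ({i..} - T) = lin n ^ 2 * (sq (({i..} - T) - {n}) :: 'k poly)"
          using fin[of i] by (metis finite_Diff sq_insert Diff_iff insertI1)
        then show ?thesis using False by (simp add: lat_def * mult_ac)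
      qed (simp add: lat_def * mult_ac)
    qed
    ultimately show ?thesis using False by simp
  qed
qed

text \<open>A constant, so that simplification does not take the set operations apart.\<close>

definition toggle :: "int set \<Rightarrow> int set \<Rightarrow> int set" where
  "toggle T F = sym_diff T F"

lemma foldr_iota_lat:
  fixes g :: "'k::field_char_0 poly"
  assumes "distinct js" "lat_type T" "g \<noteq> 0"
  shows "lat_type (toggle T (set js)) \<and>
    foldr iota js (glat (lat g T)) = glat (lat (g * sq (set js - T)) (toggle T (set js)))"
  using assms(1)
proof (induction js)
  case Nil
  then show ?case using assms(2) by (simp add: toggle_def)
next
  case (Cons j js)
  then have IH: "lat_type (toggle T (set js))"
    "foldr iota js (glat (lat g T)) = glat (lat (g * sq (set js - T)) (toggle T (set js)))"
    and j: "j \<notin> set js" by simp_all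
  have nz: "g * sq (set js - T) \<noteq> 0" using assms(3) by simp
  show ?case
  proof (cases "j \<in> T")
    case True
    have "toggle T (set (j # js)) = toggle T (set js) - {j}" using True j by (auto simp: toggle_def)
    moreover have "set (j # js) - T = set js - T" using True by auto
    moreover have "j \<in> toggle T (set js)" using True j by (simp add: toggle_def)
    ultimately show ?thesis using IH iota_lat[OF IH(1) nz, of j] lat_type_update(2) by simp
  next
    case False
    have "toggle T (set (j # js)) = insert j (toggle T (set js))" using False j by (auto simp: toggle_def)
    moreover have "set (j # js) - T = insert j (set js - T)" using False by auto
    moreover have "j \<notin> toggle T (set js)" using False j by (simp add: toggle_def)
    ultimately show ?thesis using IH iota_lat[OF IH(1) nz, of j] lat_type_update(1) j
      by (simp add: sq_insert mult_ac)
  qed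
qed

lemma iota_fset_lat:
  fixes g :: "'k::field_char_0 poly"
  assumes "lat_type T" "g \<noteq> 0"
  shows "lat_type (toggle T (fset J))"
    "iota_fset J (glat (lat g T)) = glat (lat (g * sq (fset J - T)) (toggle T (fset J)))"
  using foldr_iota_lat[OF _ assms, of "sorted_list_of_fset J"]
  by (simp_all add: iota_fset_def sorted_list_of_fset.rep_eq)

lemma A_sub_lat: "(A_sub :: 'k::field qgr set) = glat (lat 1 {0..})"
proof -
  have "{i..} - {0..} = {i..<0}" for i :: int by auto
  then have "lat 1 {0..} = (\<lambda>i. sq {i..<0} :: 'k poly)" by (simp add: lat_def fun_eq_iff)
  then show ?thesis by (simp only: A_sub_glat)
qed

lemma hpoly_sq: "hpoly J = sq (fset J)"
  by (simp add: hpoly_def sq_def lin_def)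

lemma hpoly_nonzero [simp]: "hpoly J \<noteq> 0"
  by (simp add: hpoly_sq)

lemma lat_type_A: "lat_type {0..}"
  by (simp add: lat_type_def)

section \<open>Homogeneous components and products of \<open>B\<close>\<close>

text \<open>The module \<open>P\<close> is a lattice whose degree zero component is \<open>h k[z]\<close>. Since \<open>A\<close> is generated by
  \<open>1\<close>, this decides which left multiplications by polynomials map \<open>A\<close> into \<open>P\<close>.\<close>

definition degree_zero_gen :: "'k::field qgr set \<Rightarrow> 'k poly \<Rightarrow> bool" where
  "degree_zero_gen P h \<longleftrightarrow> (\<exists>p. A_stable p \<and> P = glat p \<and> p 0 = h)"

lemma degree_zero_gen_lat:
  assumes "lat_type T"
  shows "degree_zero_gen (glat (lat g T)) (g * sq ({0..} - T))"
  unfolding degree_zero_gen_def using A_stable_lat[OF assms, of g] by (auto simp: lat_def)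

lemma degree_zero_A: "degree_zero_gen (A_sub :: 'k::field_char_0 qgr set) 1"
  using degree_zero_gen_lat[OF lat_type_A, of 1] by (simp add: A_sub_lat)

text \<open>In degree zero, the factors \<open>(z + j)\<^sup>2\<close> with \<open>j < 0\<close> come from the common factor of \<open>\<iota>\<^sub>J\<close> applied
  to the lattice, and those with \<open>j \<ge> 0\<close> from its type.\<close>

lemma degree_zero_iota_lat:
  fixes h :: "'k::field_char_0 poly"
  assumes "h \<noteq> 0"
  shows "degree_zero_gen (iota_fset J (glat (lat h {0..}))) (h * hpoly J)"
proof -
  have "fset J - {0..} \<union> ({0..} - toggle {0..} (fset J)) = fset J" by (auto simp: toggle_def)
  moreover have "sq (fset J - {0..} \<union> ({0..} - toggle {0..} (fset J)))
      = sq (fset J - {0..}) * (sq ({0..} - toggle {0..} (fset J)) :: 'k poly)"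
    by (rule sq_union) (auto simp: toggle_def intro: finite_subset[of _ "fset J"])
  ultimately have "hpoly J = sq (fset J - {0..}) * (sq ({0..} - toggle {0..} (fset J)) :: 'k poly)"
    unfolding hpoly_sq by simp
  then show ?thesis
    using iota_fset_lat[OF lat_type_A assms, of J]
      degree_zero_gen_lat[of "toggle {0..} (fset J)" "h * sq (fset J - {0..})"]
    by (simp add: mult.assoc)
qed

lemma degree_zero_iota: "degree_zero_gen (iota_fset J A_sub :: 'k::field_char_0 qgr set) (hpoly J)"
  using degree_zero_iota_lat[of "1 :: 'k poly" J] by (simp add: A_sub_lat)

text \<open>Toggling twice restores the type, and leaves the common factor \<open>h\<^sub>J\<close>.\<close>

lemma iota_iota_A:
  "iota_fset J (iota_fset J A_sub) = (glat (lat (hpoly J) {0..}) :: 'k::field_char_0 qgr set)"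
proof -
  note T = iota_fset_lat[OF lat_type_A, of _ J]
  have "iota_fset J (iota_fset J A_sub) = (glat (lat (sq (fset J - {0..}) * sq (fset J - toggle {0..} (fset J)))
      (toggle (toggle {0..} (fset J)) (fset J))) :: 'k qgr set)"
    using T(2)[of "1 :: 'k poly"] iota_fset_lat(2)[OF T(1), of "1 :: 'k poly" "sq (fset J - {0..})" J]
    by (simp add: A_sub_lat)
  moreover have "toggle (toggle {0..} (fset J)) (fset J) = {0..}" by (auto simp: toggle_def)
  moreover have "sq (fset J - {0..}) * sq (fset J - toggle {0..} (fset J)) = (hpoly J :: 'k poly)"
  proof -
    have "fset J - toggle {0..} (fset J) = fset J - (fset J - {0..})" by (auto simp: toggle_def)
    then show ?thesis unfolding hpoly_sq by (simp add: sq_diff[of "fset J" "fset J - {0..}"])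
  qed
  ultimately show ?thesis by simp
qed

lemma degree_zero_iota_iota:
  "degree_zero_gen (iota_fset J (iota_fset J A_sub) :: 'k::field_char_0 qgr set) (hpoly J)"
  unfolding iota_iota_A using degree_zero_gen_lat[OF lat_type_A, of "hpoly J"] by simp

lemma degree_zero_iota_iota_iota:
  "degree_zero_gen (iota_fset L (iota_fset J (iota_fset J A_sub)) :: 'k::field_char_0 qgr set) (hpoly J * hpoly L)"
  unfolding iota_iota_A by (rule degree_zero_iota_lat) simp

lemma degree_zero_gen_mult:
  assumes "degree_zero_gen P h" "h dvd f" "q \<in> A_sub"
  shows "qcoef f * q \<in> P"
proof -
  obtain p where p: "A_stable p" "P = glat p" "p 0 = h" using assms(1) by (auto simp: degree_zero_gen_def)
  then have "qcoef f \<in> glat p" using assms(2) by (simp add: qcoef_in_glat)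
  then show ?thesis using glat_mult_q_eval[OF p(1)] assms(3) p(2) by (auto simp: A_sub_range)
qed

lemma one_in_A: "1 \<in> A_sub"
  unfolding A_sub_range by (metis q_eval_one rangeI)

lemma A_sub_add: "q \<in> A_sub \<Longrightarrow> r \<in> A_sub \<Longrightarrow> q + r \<in> A_sub"
  by (simp add: A_sub_glat glat_add)

lemma A_sub_mult: "q \<in> A_sub \<Longrightarrow> q * q_eval a \<in> A_sub"
  unfolding A_sub_range by (auto simp flip: q_eval_mult)

lemma left_mult_apply: "q \<in> A_sub \<Longrightarrow> left_mult p q = qcoef p * q"
  by (simp add: left_mult_def)

lemma left_mult_inject [simp]: "left_mult p = left_mult q \<longleftrightarrow> p = q"
proof
  assume "left_mult p = left_mult q"
  then have "qcoef p = qcoef q" using left_mult_apply[OF one_in_A] by (metis mult.right_neutral)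
  then have "qlook (qcoef p) 0 = qlook (qcoef q) 0" by simp
  then show "p = q" by simp
qed simp

lemma left_mult_0: "left_mult 0 = B_zero_hom"
  by (simp add: left_mult_def B_zero_hom_def)

text \<open>A homomorphism \<open>A \<rightarrow> \<iota>\<^sub>J A\<close> is left multiplication by the image of \<open>1\<close>, which lies in the degree
  zero component of \<open>\<iota>\<^sub>J A\<close>.\<close>

lemma B_hom_eq: "B_hom J = range (\<lambda>v :: 'k::field_char_0 poly. left_mult (hpoly J * v))"
proof (intro equalityI subsetI)
  note deg = degree_zero_iota[of J, where 'k = 'k]
  obtain p :: "int \<Rightarrow> 'k poly" where p: "A_stable p" "iota_fset J A_sub = glat p" "p 0 = hpoly J"
    using deg by (auto simp: degree_zero_gen_def)
  {
    fix f :: "'k qgr \<Rightarrow> 'k qgr"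
    assume "f \<in> B_hom J"
    then have f: "f \<in> gr_hom (q_mod A_sub) (q_mod (glat p))" by (simp add: B_hom_def p(2))
    have "1 \<in> mcomp (q_mod A_sub) 0"
      using one_in_A by (simp add: q_comp_iff)
    from gr_homD(4)[OF f this] have f1: "f 1 \<in> glat p" "f 1 \<in> q_comp 0" by simp_all
    obtain u where u: "\<forall>i. qlook (f 1) i = to_fract (p i * u i)" using f1(1) by (rule glatE)
    have "f 1 = qcoef (hpoly J * u 0)"
      by (rule qgr_eqI) (use u f1(2) p(3) in \<open>auto simp: q_comp_iff\<close>)
    moreover have "f (q_eval a) = f 1 * q_eval a" for a
      using gr_homD(3)[OF f, of 1 a] one_in_A by simp
    ultimately have "f q = left_mult (hpoly J * u 0) q" if "q \<in> A_sub" for q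
      using that by (auto simp: left_mult_apply) (auto simp: A_sub_range)
    moreover have "f \<in> extensional A_sub" "left_mult (hpoly J * u 0) \<in> extensional A_sub"
      using gr_homD(1)[OF f] by (auto simp: PiE_def left_mult_def)
    ultimately have "f = left_mult (hpoly J * u 0)" by (intro extensionalityI)
    then show "f \<in> range (\<lambda>v. left_mult (hpoly J * v))" by blast
  next
    fix f :: "'k qgr \<Rightarrow> 'k qgr"
    assume "f \<in> range (\<lambda>v. left_mult (hpoly J * v))"
    then obtain v where v: "f = left_mult (hpoly J * v)" by blast
    have "f q \<in> iota_fset J A_sub" if "q \<in> A_sub" for q
      using degree_zero_gen_mult[OF deg _ that] that by (simp add: v left_mult_apply)
    then show "f \<in> B_hom J"
      by (auto simp: B_hom_def gr_hom_def v left_mult_apply A_sub_add A_sub_mult distrib_left mult.assoc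
          q_comp_iff) (simp add: left_mult_def)
  }
qed

text \<open>All maps entering the product are restrictions of left multiplications by elements of \<open>k(z)\<close>,
  the last one by \<open>h\<^bsub>I \<inter> J\<^esub>\<^sup>-\<^sup>1\<close>. The divisibility hypotheses ensure that each intermediate value
  lies in the domain of the next map.\<close>

lemma B_times_left_mult:
  fixes f g t :: "'k::field_char_0 poly"
  assumes "hpoly I dvd f" "hpoly J dvd g" "hpoly (I |\<inter>| J) * t = f * g"
    and fg: "hpoly (I |\<inter>| J) * hpoly (I \<oplus>\<^sub>Z J) dvd f * g"
  shows "B_times I J (left_mult f) (left_mult g) = left_mult t"
proof
  fix q :: "'k qgr"
  let ?K = "I |\<inter>| J"
  show "B_times I J (left_mult f) (left_mult g) q = left_mult t q"
  proof (cases "q \<in> A_sub")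
    case True
    have g: "qcoef g * q \<in> iota_fset J A_sub" "qcoef g * q \<in> A_sub"
      using degree_zero_gen_mult[OF degree_zero_iota assms(2) True]
        degree_zero_gen_mult[OF degree_zero_A _ True] by auto
    have eq: "qcoef f * (qcoef g * q) = qcoef (f * g) * q" by (simp add: qcoef_mult flip: mult.assoc)
    have "qcoef (f * g) * q \<in> iota_fset (I \<oplus>\<^sub>Z J) (iota_fset ?K (iota_fset ?K A_sub))"
      by (rule degree_zero_gen_mult[OF degree_zero_iota_iota_iota fg True])
    moreover have "qcoef (f * g) * q \<in> iota_fset ?K (iota_fset ?K A_sub)"
      by (rule degree_zero_gen_mult[OF degree_zero_iota_iota _ True]) (use fg in \<open>auto dest: dvd_mult_left\<close>)
    moreover have "qmono (inverse (to_fract (hpoly ?K))) 0 * (qcoef (f * g) * q) = qcoef t * q"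
    proof -
      have "qmono (inverse (to_fract (hpoly ?K))) 0 * qcoef (f * g) = qcoef t"
        unfolding assms(3)[symmetric] by (simp add: qcoef_def qmono_mult flip: mult.assoc)
      then show ?thesis by (simp flip: mult.assoc)
    qed
    ultimately show ?thesis using True g
      by (simp add: B_times_def Let_def compose_def iota_hom_def sigma_hom_def left_mult_apply eq)
  qed (simp add: B_times_def Let_def compose_def left_mult_def)
qed

section \<open>The group ring of \<open>\<int>\<^sub>f\<^sub>i\<^sub>n\<close> over \<open>k[z]\<close>\<close>

text \<open>With symmetric difference as addition on finite sets, the convolution product of finitely
  supported maps \<^typ>\<open>int fset \<Rightarrow>\<^sub>0 'a\<close> is that of the group ring of \<open>\<int>\<^sub>f\<^sub>i\<^sub>n\<close>.\<close>

instantiation fset :: (type) comm_monoid_add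
begin
definition "0 = ({||} :: 'a fset)"
definition "A + B = (A |-| B) |\<union>| (B |-| A)" for A B :: "'a fset"
instance by standard (auto simp: zero_fset_def plus_fset_def)
end

lemma zfin_add_eq: "I \<oplus>\<^sub>Z J = I + J"
  by (simp add: zfin_add_def plus_fset_def)

lemma fset_plus: "fset (I + J) = (fset I - fset J) \<union> (fset J - fset I)"
  by (simp add: plus_fset_def)

lemma fset_zero [simp]: "fset 0 = {}"
  by (simp add: zero_fset_def)

definition sqrt_hpoly :: "int fset \<Rightarrow> 'k::field poly" where
  "sqrt_hpoly J = (\<Prod>j\<in>fset J. lin j)"

lemma sqrt_hpoly_nonzero [simp]: "sqrt_hpoly J \<noteq> 0"
  by (simp add: sqrt_hpoly_def)

lemma sqrt_hpoly_zero [simp]: "sqrt_hpoly 0 = 1"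
  by (simp add: sqrt_hpoly_def)

lemma sqrt_hpoly_singleton [simp]: "sqrt_hpoly {|n|} = lin n"
  by (simp add: sqrt_hpoly_def)

lemma sqrt_hpoly_square: "sqrt_hpoly J * sqrt_hpoly J = hpoly J"
  by (simp add: sqrt_hpoly_def hpoly_sq sq_def power2_eq_square flip: prod.distrib)

text \<open>This identity turns the product of \<open>B\<close>, which divides by \<open>h\<^bsub>I \<inter> J\<^esub>\<close>, into the product of the
  group ring.\<close>

lemma sqrt_hpoly_mult: "sqrt_hpoly I * sqrt_hpoly J = hpoly (I |\<inter>| J) * sqrt_hpoly (I + J)"
proof -
  have "(\<Prod>j\<in>fset I. f j) * (\<Prod>j\<in>fset J. f j)
      = (\<Prod>j\<in>fset I \<inter> fset J. f j ^ 2) * (\<Prod>j\<in>fset (I + J). f j)" for f :: "int \<Rightarrow> 'a poly"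
  proof -
    let ?d = "\<Prod>j\<in>fset I \<inter> fset J. f j"
    have "(\<Prod>j\<in>fset I. f j) = ?d * (\<Prod>j\<in>fset I - fset J. f j)"
      by (rule prod.Int_Diff) simp
    moreover have "(\<Prod>j\<in>fset J. f j) = ?d * (\<Prod>j\<in>fset J - fset I. f j)"
      unfolding Int_commute[of "fset I"] by (rule prod.Int_Diff) simp
    moreover have "(\<Prod>j\<in>fset (I + J). f j) = (\<Prod>j\<in>fset I - fset J. f j) * (\<Prod>j\<in>fset J - fset I. f j)"
      unfolding fset_plus by (rule prod.union_disjoint) auto
    ultimately show ?thesis by (simp add: power2_eq_square prod.distrib mult_ac)
  qed
  then show ?thesis by (simp add: sqrt_hpoly_def hpoly_sq sq_def)
qed

text \<open>The degree in \<open>\<int>\<^sub>f\<^sub>i\<^sub>n\<close> of the monomial with exponents \<open>m\<close>.\<close>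

definition odd_support :: "(int \<Rightarrow>\<^sub>0 nat) \<Rightarrow> int fset" where
  "odd_support m = Abs_fset {n. odd (Poly_Mapping.lookup m n)}"

lemma fset_odd_support: "fset (odd_support m) = {n. odd (Poly_Mapping.lookup m n)}"
proof -
  have "{n. odd (Poly_Mapping.lookup m n)} \<subseteq> Poly_Mapping.keys m"
    by (auto simp: in_keys_iff intro: odd_pos)
  then show ?thesis unfolding odd_support_def by (intro Abs_fset_inverse) (auto intro: finite_subset)
qed

lemma odd_support_add: "odd_support (m + m') = odd_support m + odd_support m'"
  by (rule fset_inject[THEN iffD1]) (auto simp: fset_odd_support fset_plus lookup_add)

text \<open>The value of the monomial with exponents \<open>m\<close> at \<open>b\<^sub>n = z + n\<close>.\<close>

definition mon_val :: "(int \<Rightarrow>\<^sub>0 nat) \<Rightarrow> 'k::field poly" where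
  "mon_val m = (\<Prod>n\<in>Poly_Mapping.keys m. lin n ^ Poly_Mapping.lookup m n)"

lemma mon_val_superset:
  "finite N \<Longrightarrow> Poly_Mapping.keys m \<subseteq> N \<Longrightarrow> mon_val m = (\<Prod>n\<in>N. lin n ^ Poly_Mapping.lookup m n)"
  unfolding mon_val_def by (rule prod.mono_neutral_left) (auto simp: in_keys_iff)

lemma mon_val_add: "mon_val (m + m') = mon_val m * mon_val m'"
proof -
  have "Poly_Mapping.keys (m + m') \<subseteq> Poly_Mapping.keys m \<union> Poly_Mapping.keys m'" by (rule keys_add)
  then show ?thesis
    by (subst (1 2 3) mon_val_superset[of "Poly_Mapping.keys m \<union> Poly_Mapping.keys m'"])
       (auto simp: lookup_add power_add prod.distrib)
qed

lemma sqrt_hpoly_odd_support_dvd: "sqrt_hpoly (odd_support m) dvd mon_val m"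
proof -
  have "sqrt_hpoly (odd_support m) = (\<Prod>n\<in>Poly_Mapping.keys m. if odd (Poly_Mapping.lookup m n) then lin n else 1)"
    unfolding sqrt_hpoly_def fset_odd_support
    by (subst prod.inter_filter[symmetric]) (auto intro!: prod.cong simp: in_keys_iff intro: odd_pos)
  also have "\<dots> dvd mon_val m"
    unfolding mon_val_def by (rule prod_dvd_prod) (auto intro!: dvd_power odd_pos)
  finally show ?thesis .
qed

text \<open>The homomorphism \<open>k[z][b\<^sub>n] \<rightarrow> k[z][\<int>\<^sub>f\<^sub>i\<^sub>n]\<close> with \<open>b\<^sub>n \<mapsto> (z + n) t\<^sub>n\<close>, where \<open>t\<^sub>n\<close> is the group
  element \<open>{n}\<close>.\<close>

definition to_group_ring :: "'k::field bpoly \<Rightarrow> (int fset \<Rightarrow>\<^sub>0 'k poly)" where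
  "to_group_ring = lin_ext (\<lambda>m c. Poly_Mapping.single (odd_support m) (c * mon_val m))"

lemma to_group_ring_single:
  "to_group_ring (Poly_Mapping.single m c) = Poly_Mapping.single (odd_support m) (c * mon_val m)"
  unfolding to_group_ring_def by (rule lin_ext_single) simp

lemma to_group_ring_add: "to_group_ring (p + q) = to_group_ring p + to_group_ring q"
  unfolding to_group_ring_def by (rule lin_ext_add) (simp_all add: distrib_right single_add)

lemma to_group_ring_0 [simp]: "to_group_ring 0 = 0"
  by (simp add: to_group_ring_def)

lemma to_group_ring_diff: "to_group_ring (p - q) = to_group_ring p - to_group_ring q"
  using to_group_ring_add[of "p - q" q] by (simp add: algebra_simps)

lemma to_group_ring_mult: "to_group_ring (p * q) = to_group_ring p * to_group_ring q"
proof (induction p rule: poly_mapping_single_induct)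
  case (add m c p)
  have "to_group_ring (Poly_Mapping.single m c * q) = to_group_ring (Poly_Mapping.single m c) * to_group_ring q"
    by (induction q rule: poly_mapping_single_induct)
       (simp_all add: distrib_left to_group_ring_add mult_single to_group_ring_single odd_support_add mon_val_add mult_ac)
  then show ?case using add by (simp add: distrib_right to_group_ring_add)
qed simp

lemma odd_support_zero [simp]: "odd_support 0 = 0"
  by (rule fset_inject[THEN iffD1]) (simp add: fset_odd_support)

lemma mon_val_zero [simp]: "mon_val 0 = 1"
  by (simp add: mon_val_def)

lemma to_group_ring_bconst: "to_group_ring (bconst c) = Poly_Mapping.single 0 c"
  by (simp add: bconst_def to_group_ring_single)

lemma to_group_ring_1: "to_group_ring 1 = 1"
  using to_group_ring_bconst[of 1] by (simp add: bconst_def)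

lemma odd_support_single: "odd_support (Poly_Mapping.single n 1) = {|n|}"
  by (rule fset_inject[THEN iffD1]) (auto simp: fset_odd_support lookup_single when_def)

lemma to_group_ring_bvar: "to_group_ring (bvar n) = Poly_Mapping.single {|n|} (lin n)"
  unfolding bvar_def to_group_ring_single odd_support_single by (simp add: mon_val_def)

text \<open>The image consists of elements whose component at \<open>J\<close> is divisible by \<open>s\<^sub>J\<close>, since a monomial
  of degree \<open>J\<close> contains \<open>b\<^sub>j\<close> for every \<open>j \<in> J\<close>.\<close>

lemma sqrt_hpoly_dvd_to_group_ring: "sqrt_hpoly J dvd Poly_Mapping.lookup (to_group_ring p) J"
  by (induction p rule: poly_mapping_single_induct)
     (auto simp: to_group_ring_add to_group_ring_single lookup_add lookup_single when_def sqrt_hpoly_odd_support_dvd)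

text \<open>The exponents of the monomial \<open>b\<^sub>J = \<Prod>\<^bsub>j \<in> J\<^esub> b\<^sub>j\<close>.\<close>

definition squarefree_exp :: "int fset \<Rightarrow> (int \<Rightarrow>\<^sub>0 nat)" where
  "squarefree_exp J = Abs_poly_mapping (\<lambda>n. if n |\<in>| J then 1 else 0)"

lemma lookup_squarefree_exp: "Poly_Mapping.lookup (squarefree_exp J) n = (if n |\<in>| J then 1 else 0)"
proof -
  have "finite {n. (if n |\<in>| J then 1 else 0 :: nat) \<noteq> 0}" by simp
  then show ?thesis unfolding squarefree_exp_def by (subst lookup_Abs_poly_mapping) simp_all
qed

lemma odd_support_squarefree_exp [simp]: "odd_support (squarefree_exp J) = J"
  by (rule fset_inject[THEN iffD1]) (auto simp: fset_odd_support lookup_squarefree_exp)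

lemma mon_val_squarefree_exp [simp]: "mon_val (squarefree_exp J) = sqrt_hpoly J"
proof -
  have "Poly_Mapping.keys (squarefree_exp J) = fset J" by (auto simp: in_keys_iff lookup_squarefree_exp split: if_splits)
  then show ?thesis by (simp add: mon_val_def sqrt_hpoly_def lookup_squarefree_exp)
qed

definition B_normal :: "(int fset \<Rightarrow>\<^sub>0 'k::field poly) \<Rightarrow> 'k bpoly" where
  "B_normal = lin_ext (\<lambda>J c. Poly_Mapping.single (squarefree_exp J) c)"

lemma B_normal_add: "B_normal (u + v) = B_normal u + B_normal v"
  unfolding B_normal_def by (rule lin_ext_add) (simp_all add: single_add)

lemma B_normal_single: "B_normal (Poly_Mapping.single J c) = Poly_Mapping.single (squarefree_exp J) c"
  unfolding B_normal_def by (rule lin_ext_single) simp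

lemma lookup_to_group_ring_normal:
  "Poly_Mapping.lookup (to_group_ring (B_normal u)) J = Poly_Mapping.lookup u J * sqrt_hpoly J"
  by (induction u rule: poly_mapping_single_induct)
     (auto simp: B_normal_add B_normal_single to_group_ring_add to_group_ring_single lookup_add lookup_single when_def
        distrib_right, simp add: B_normal_def)

text \<open>If \<open>b\<^sub>n\<close> already occurs in the monomial, the relation replaces \<open>b\<^sub>n\<^sup>2\<close> by a polynomial in \<open>z\<close>.\<close>

lemma bvar_squarefree_exp_class:
  "\<exists>I d. presented_class B_rels (bvar n * Poly_Mapping.single (squarefree_exp J) c)
     = presented_class B_rels (Poly_Mapping.single (squarefree_exp I) d)"
proof (cases "n |\<in>| J")
  case False
  have "Poly_Mapping.single n 1 + squarefree_exp J = squarefree_exp (finsert n J)"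
    by (rule poly_mapping_eqI) (use False in \<open>auto simp: lookup_add lookup_squarefree_exp lookup_single when_def\<close>)
  then have "bvar n * Poly_Mapping.single (squarefree_exp J) c = Poly_Mapping.single (squarefree_exp (finsert n J)) c"
    by (simp add: bvar_def mult_single)
  then show ?thesis by metis
next
  case True
  have "squarefree_exp J = Poly_Mapping.single n 1 + squarefree_exp (J |-| {|n|})"
    by (rule poly_mapping_eqI) (use True in \<open>auto simp: lookup_add lookup_squarefree_exp lookup_single when_def\<close>)
  then have "bvar n * Poly_Mapping.single (squarefree_exp J) c
      = bvar n ^ 2 * Poly_Mapping.single (squarefree_exp (J |-| {|n|})) c"
    by (simp add: bvar_def mult_single power2_eq_square add.assoc)
  moreover have "presented_class B_rels (bvar n ^ 2) = presented_class B_rels (bconst ([:of_int n, 1:] ^ 2) :: 'a bpoly)"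
    by (rule presented_class_rel) (auto simp: B_rels_def)
  ultimately have "presented_class B_rels (bvar n * Poly_Mapping.single (squarefree_exp J) c)
      = presented_class B_rels (bconst ([:of_int n, 1:] ^ 2) * Poly_Mapping.single (squarefree_exp (J |-| {|n|})) c)"
    by (metis presented_class_cong(2))
  then show ?thesis unfolding bconst_def mult_single add_0 by blast
qed

lemma monomial_class:
  "\<exists>I d. presented_class B_rels (Poly_Mapping.single m c)
     = presented_class B_rels (Poly_Mapping.single (squarefree_exp I) d)"
proof (induction m rule: poly_mapping_single_induct)
  case zero
  have "squarefree_exp {||} = 0" by (rule poly_mapping_eqI) (simp add: lookup_squarefree_exp)
  then show ?case by metis
next
  case (add n k m)
  show ?case
  proof (induction k)
    case (Suc k)
    then obtain I d where "presented_class B_rels (Poly_Mapping.single (Poly_Mapping.single n k + m) c)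
      = presented_class B_rels (Poly_Mapping.single (squarefree_exp I) d)" by blast
    from presented_class_cong(2)[OF refl this, of "bvar n"] bvar_squarefree_exp_class[of n I d]
    show ?case by (simp add: bvar_def mult_single flip: add.assoc single_add)
  qed (use add in simp)
qed

lemma B_normal_form: "\<exists>u. presented_class B_rels p = presented_class B_rels (B_normal u)"
proof (induction p rule: poly_mapping_single_induct)
  case zero
  show ?case by (intro exI[of _ 0]) (simp add: B_normal_def)
next
  case (add m c p)
  then obtain u where u: "presented_class B_rels p = presented_class B_rels (B_normal u)" by blast
  obtain I d where "presented_class B_rels (Poly_Mapping.single m c)
      = presented_class B_rels (Poly_Mapping.single (squarefree_exp I) d)" using monomial_class by blast
  from presented_class_cong(1)[OF this u] show ?case
    unfolding B_normal_single[symmetric] B_normal_add[symmetric] by blast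
qed

lemma ring_hom_to_group_ring: "ring_hom_ring univ_ring univ_ring (to_group_ring :: 'k::field bpoly \<Rightarrow> _)"
  by (rule ring_hom_ringI[OF ring_univ_ring ring_univ_ring])
     (simp_all add: to_group_ring_add to_group_ring_mult to_group_ring_1)

text \<open>Modulo the relations every element is a combination \<open>\<Sum> u\<^sub>J(z) b\<^sub>J\<close>, with image
  \<open>\<Sum> u\<^sub>J(z) s\<^sub>J J\<close>; this determines all \<open>u\<^sub>J\<close>.\<close>

lemma to_group_ring_kernel: "to_group_ring p = 0 \<longleftrightarrow> p \<in> genideal univ_ring B_rels"
proof
  interpret R: ring "univ_ring :: 'a bpoly ring" by (rule ring_univ_ring)
  have ker: "a_kernel univ_ring univ_ring to_group_ring = {p :: 'a bpoly. to_group_ring p = 0}"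
    by (simp add: a_kernel_def' )
  have "B_rels \<subseteq> {p :: 'a bpoly. to_group_ring p = 0}"
  proof
    fix r :: "'a bpoly" assume "r \<in> B_rels"
    then obtain n where "r = bvar n ^ 2 - bconst ([:of_int n, 1:] ^ 2)" by (auto simp: B_rels_def)
    moreover have "{|n|} + {|n|} = (0 :: int fset)" by (simp add: plus_fset_def zero_fset_def)
    ultimately show "r \<in> {p. to_group_ring p = 0}"
      by (simp add: to_group_ring_diff to_group_ring_bconst power2_eq_square
          to_group_ring_mult to_group_ring_bvar mult_single lin_def)
  qed
  moreover have "ideal {p :: 'a bpoly. to_group_ring p = 0} univ_ring"
    unfolding ker[symmetric] by (rule ring_hom_ring.kernel_is_ideal[OF ring_hom_to_group_ring])
  ultimately have sub: "genideal univ_ring B_rels \<subseteq> {p :: 'a bpoly. to_group_ring p = 0}"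
    by (intro R.genideal_minimal)
  then show "to_group_ring p = 0" if "p \<in> genideal univ_ring B_rels" using that by blast
  assume p: "to_group_ring p = 0"
  obtain u where "presented_class B_rels p = presented_class B_rels (B_normal u)"
    using B_normal_form by blast
  then have diff: "p - B_normal u \<in> genideal univ_ring B_rels" by (simp add: presented_class_eq_iff)
  then have "to_group_ring (B_normal u) = 0" using sub p by (auto simp: to_group_ring_diff)
  then have "u = 0"
    by (intro poly_mapping_eqI) (metis lookup_to_group_ring_normal lookup_zero mult_eq_0_iff sqrt_hpoly_nonzero)
  then show "p \<in> genideal univ_ring B_rels" using diff by (simp add: B_normal_def)
qed

section \<open>The presentation of \<open>B\<close>\<close>

text \<open>The map from the group ring to families of left multiplications. On the elements whose
  component at \<open>J\<close> is \<open>s\<^sub>J v\<close>, that component becomes the multiplication by \<open>h\<^sub>J v\<close>, an element of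
  \<open>B\<^sub>J\<close>.\<close>

definition B_elem :: "(int fset \<Rightarrow>\<^sub>0 'k::field poly) \<Rightarrow> int fset \<Rightarrow> 'k qgr \<Rightarrow> 'k qgr" where
  "B_elem u J = left_mult (sqrt_hpoly J * Poly_Mapping.lookup u J)"

lemma B_support_elem: "B_support (B_elem u) = Poly_Mapping.keys u"
  by (auto simp: B_support_def B_elem_def in_keys_iff simp flip: left_mult_0)

lemma B_elem_inject: "B_elem u = B_elem v \<longleftrightarrow> u = v"
proof
  assume "B_elem u = B_elem v"
  then have "sqrt_hpoly J * Poly_Mapping.lookup u J = sqrt_hpoly J * Poly_Mapping.lookup v J" for J
    by (metis B_elem_def left_mult_inject)
  then show "u = v" by (intro poly_mapping_eqI) simp
qed simp

lemma B_elem_zero: "B_elem 0 = (\<lambda>_. B_zero_hom)"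
  by (simp add: B_elem_def fun_eq_iff flip: left_mult_0)

lemma B_elem_single: "B_elem (Poly_Mapping.single J c) = B_incl J (left_mult (sqrt_hpoly J * c))"
  by (auto simp: B_elem_def B_incl_def fun_eq_iff lookup_single when_def simp flip: left_mult_0)

lemma B_elem_add: "B_elem (u + v) = B_elem u \<oplus>\<^bsub>ringB\<^esub> B_elem v"
  by (auto simp: ringB_def B_elem_def fun_eq_iff lookup_add left_mult_def distrib_left distrib_right
      simp flip: qcoef_add)

lemma B_elem_one: "B_elem 1 = \<one>\<^bsub>ringB\<^esub>"
proof -
  have "B_elem 1 = B_incl 0 (left_mult 1)"
    using B_elem_single[of 0 1] by simp
  then show ?thesis by (simp add: ringB_def left_mult_def zero_fset_def)
qed

lemma poly_mapping_sum_single: "u = (\<Sum>i\<in>Poly_Mapping.keys u. Poly_Mapping.single i (Poly_Mapping.lookup u i))"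
  by (rule poly_mapping_eqI) (simp add: lookup_sum lookup_single when_def sum.delta in_keys_iff)

lemma lookup_mult_sum:
  "Poly_Mapping.lookup (u * v) K = (\<Sum>(I, J)\<in>{(I, J). I \<in> Poly_Mapping.keys u \<and> J \<in> Poly_Mapping.keys v \<and> I + J = K}.
     Poly_Mapping.lookup u I * Poly_Mapping.lookup v J)"
proof -
  have "u * v = (\<Sum>(I, J)\<in>Poly_Mapping.keys u \<times> Poly_Mapping.keys v.
      Poly_Mapping.single (I + J) (Poly_Mapping.lookup u I * Poly_Mapping.lookup v J))"
    by (subst poly_mapping_sum_single[of u], subst poly_mapping_sum_single[of v])
       (simp add: sum_product sum.cartesian_product mult_single)
  then have "Poly_Mapping.lookup (u * v) K = (\<Sum>(I, J)\<in>Poly_Mapping.keys u \<times> Poly_Mapping.keys v.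
      if I + J = K then Poly_Mapping.lookup u I * Poly_Mapping.lookup v J else 0)"
    by (simp add: lookup_sum lookup_single when_def case_prod_unfold)
  also have "\<dots> = (\<Sum>x\<in>{x \<in> Poly_Mapping.keys u \<times> Poly_Mapping.keys v. fst x + snd x = K}.
      Poly_Mapping.lookup u (fst x) * Poly_Mapping.lookup v (snd x))"
    by (simp add: sum.inter_filter case_prod_unfold)
  also have "{x \<in> Poly_Mapping.keys u \<times> Poly_Mapping.keys v. fst x + snd x = K}
      = {(I, J). I \<in> Poly_Mapping.keys u \<and> J \<in> Poly_Mapping.keys v \<and> I + J = K}" by auto
  finally show ?thesis by (simp add: case_prod_unfold)
qed

lemma qcoef_sum: "qcoef (sum f A) = (\<Sum>a\<in>A. qcoef (f a))"
  by (induction A rule: infinite_finite_induct) (simp_all flip: qcoef_add)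

text \<open>The factor \<open>s\<^sub>I s\<^sub>J / h\<^bsub>I \<inter> J\<^esub>\<close> in the product of \<open>B\<close> is the factor \<open>s\<^bsub>I \<oplus> J\<^esub>\<close> of the component in
  which the product lies.\<close>

lemma B_elem_mult:
  fixes u v :: "int fset \<Rightarrow>\<^sub>0 'k::field_char_0 poly"
  assumes u: "\<And>J. sqrt_hpoly J dvd Poly_Mapping.lookup u J" and v: "\<And>J. sqrt_hpoly J dvd Poly_Mapping.lookup v J"
  shows "B_elem (u * v) = B_elem u \<otimes>\<^bsub>ringB\<^esub> B_elem v"
proof
  fix K
  have times: "B_times I J (B_elem u I) (B_elem v J)
      = left_mult (sqrt_hpoly (I + J) * (Poly_Mapping.lookup u I * Poly_Mapping.lookup v J))" for I J
    unfolding B_elem_def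
  proof (rule B_times_left_mult)
    show "hpoly I dvd sqrt_hpoly I * Poly_Mapping.lookup u I" "hpoly J dvd sqrt_hpoly J * Poly_Mapping.lookup v J"
      using u v by (simp_all flip: sqrt_hpoly_square)
    show eq: "hpoly (I |\<inter>| J) * (sqrt_hpoly (I + J) * (Poly_Mapping.lookup u I * Poly_Mapping.lookup v J))
      = sqrt_hpoly I * Poly_Mapping.lookup u I * (sqrt_hpoly J * Poly_Mapping.lookup v J)"
      using sqrt_hpoly_mult[of I J, where 'a = 'k] by (simp add: mult_ac)
    have "sqrt_hpoly I * sqrt_hpoly J dvd Poly_Mapping.lookup u I * Poly_Mapping.lookup v J"
      by (rule mult_dvd_mono[OF u v])
    then have "sqrt_hpoly (I + J) dvd Poly_Mapping.lookup u I * Poly_Mapping.lookup v J"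
      unfolding sqrt_hpoly_mult by (rule dvd_mult_right)
    then show "hpoly (I |\<inter>| J) * hpoly (I \<oplus>\<^sub>Z J)
        dvd sqrt_hpoly I * Poly_Mapping.lookup u I * (sqrt_hpoly J * Poly_Mapping.lookup v J)"
      unfolding eq[symmetric] zfin_add_eq sqrt_hpoly_square[symmetric, of "I + J"]
      by (intro mult_dvd_mono dvd_refl)
  qed
  let ?S = "{(I, J). I \<in> Poly_Mapping.keys u \<and> J \<in> Poly_Mapping.keys v \<and> I + J = K}"
  have "(B_elem u \<otimes>\<^bsub>ringB\<^esub> B_elem v) K q = B_elem (u * v) K q" for q
  proof (cases "q \<in> A_sub")
    case True
    have "(B_elem u \<otimes>\<^bsub>ringB\<^esub> B_elem v) K q
        = (\<Sum>(I, J)\<in>?S. left_mult (sqrt_hpoly (I + J) * (Poly_Mapping.lookup u I * Poly_Mapping.lookup v J)) q)"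
      using True by (simp add: ringB_def B_support_elem zfin_add_eq times)
    also have "\<dots> = (\<Sum>(I, J)\<in>?S. qcoef (sqrt_hpoly K * (Poly_Mapping.lookup u I * Poly_Mapping.lookup v J)) * q)"
      using True by (intro sum.cong) (auto simp: left_mult_apply)
    also have "\<dots> = qcoef (sqrt_hpoly K * (\<Sum>(I, J)\<in>?S. Poly_Mapping.lookup u I * Poly_Mapping.lookup v J)) * q"
      by (simp add: case_prod_unfold sum_distrib_left sum_distrib_right qcoef_sum)
    also have "\<dots> = B_elem (u * v) K q"
      using True by (simp add: B_elem_def left_mult_apply lookup_mult_sum)
    finally show ?thesis .
  qed (simp add: ringB_def B_elem_def left_mult_def)
  then show "B_elem (u * v) K = (B_elem u \<otimes>\<^bsub>ringB\<^esub> B_elem v) K" by (simp add: fun_eq_iff)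
qed

text \<open>Elements of \<open>B\<^sub>J\<close> come from multiples of the squarefree monomial \<open>b\<^sub>J\<close>.\<close>

lemma B_elem_to_group_ring_range:
  "range (\<lambda>p :: 'k::field_char_0 bpoly. B_elem (to_group_ring p)) = carrier ringB"
proof (intro equalityI subsetI)
  fix F :: "int fset \<Rightarrow> 'k qgr \<Rightarrow> 'k qgr"
  assume "F \<in> range (\<lambda>p. B_elem (to_group_ring p))"
  then obtain p where F: "F = B_elem (to_group_ring p)" by blast
  have "F J \<in> B_hom J" for J
  proof -
    obtain w where "Poly_Mapping.lookup (to_group_ring p) J = sqrt_hpoly J * w"
      using sqrt_hpoly_dvd_to_group_ring by (rule dvdE)
    then have "F J = left_mult (hpoly J * w)"
      by (simp add: F B_elem_def mult.assoc flip: sqrt_hpoly_square)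
    then show ?thesis unfolding B_hom_eq by blast
  qed
  then show "F \<in> carrier ringB" by (simp add: ringB_def F B_support_elem)
next
  fix F :: "int fset \<Rightarrow> 'k qgr \<Rightarrow> 'k qgr"
  assume F: "F \<in> carrier ringB"
  then have "\<forall>J. \<exists>v. F J = left_mult (hpoly J * v)" by (auto simp: ringB_def B_hom_eq)
  then obtain v where v: "\<And>J. F J = left_mult (hpoly J * v J)" by metis
  have fin: "finite {J. v J \<noteq> 0}"
    using F v by (simp add: ringB_def B_support_def flip: left_mult_0)
  define u where "u = Abs_poly_mapping v"
  have "B_elem (to_group_ring (B_normal u)) = F"
    using fin
    by (auto simp: B_elem_def lookup_to_group_ring_normal u_def v fun_eq_iff mult_ac simp flip: sqrt_hpoly_square)
  then show "F \<in> range (\<lambda>p. B_elem (to_group_ring p))" by blast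
qed

lemma kernel_B_elem_to_group_ring:
  "a_kernel univ_ring ringB (\<lambda>p :: 'k::field bpoly. B_elem (to_group_ring p)) = genideal univ_ring B_rels"
proof -
  have "\<zero>\<^bsub>ringB\<^esub> = (B_elem 0 :: int fset \<Rightarrow> 'k qgr \<Rightarrow> 'k qgr)"
    by (simp add: ringB_def B_elem_zero)
  then show ?thesis by (simp add: a_kernel_def' B_elem_inject to_group_ring_kernel)
qed

theorem proposition4p4:
  shows "ring (ringB :: (int fset \<Rightarrow> 'k::{alg_closed_field, field_char_0} qgr \<Rightarrow> 'k qgr) ring) \<and>
    (\<exists>\<Phi> \<in> ring_iso (presented_ring (B_rels :: 'k bpoly set)) ringB.
      (\<forall>c. \<Phi> (presented_class B_rels (bconst [:c:])) = B_incl {||} (left_mult [:c:])) \<and>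
      \<Phi> (presented_class B_rels (bconst [:0, 1:])) = B_incl {||} (left_mult [:0, 1:]) \<and>
      (\<forall>n. \<Phi> (presented_class B_rels (bvar n)) = B_incl {|n|} (left_mult (hpoly {|n|}))) \<and>
      (\<forall>J. \<Phi> ` pres_comp J = B_comp J))"
proof -
  let ?h = "\<lambda>p :: 'k bpoly. B_elem (to_group_ring p)"
  let ?R = "univ_ring :: 'k bpoly ring"
  interpret R: ring ?R by (rule ring_univ_ring)
  have hom: "?h \<in> ring_hom ?R ringB"
  proof (rule ring_hom_memI)
    fix p q :: "'k bpoly"
    show "?h p \<in> carrier ringB" using B_elem_to_group_ring_range by blast
    show "?h (p \<otimes>\<^bsub>?R\<^esub> q) = ?h p \<otimes>\<^bsub>ringB\<^esub> ?h q"
      using B_elem_mult[of "to_group_ring p" "to_group_ring q"]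
      by (simp add: to_group_ring_mult sqrt_hpoly_dvd_to_group_ring)
  qed (simp_all add: to_group_ring_add B_elem_add to_group_ring_1 B_elem_one)
  have ring: "ring (ringB :: (int fset \<Rightarrow> 'k qgr \<Rightarrow> 'k qgr) ring)"
  proof -
    have "ringB\<lparr>carrier := ?h ` carrier ?R, zero := ?h \<zero>\<^bsub>?R\<^esub>\<rparr> = ringB"
      using B_elem_to_group_ring_range[where 'k = 'k] by (simp add: B_elem_zero ringB_def)
    then show ?thesis using R.ring_hom_imp_img_ring[OF hom] by simp
  qed
  interpret H: ring_hom_ring ?R ringB ?h
    by (rule ring_hom_ringI2[OF ring_univ_ring ring hom])
  note ker = kernel_B_elem_to_group_ring[where 'k = 'k]
  define \<Phi> where "\<Phi> = (\<lambda>X. the_elem (?h ` X))"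
  have iso: "\<Phi> \<in> ring_iso (presented_ring B_rels) ringB"
    using H.FactRing_iso_set B_elem_to_group_ring_range[where 'k = 'k]
    unfolding \<Phi>_def presented_ring_def ker by simp
  have \<Phi>: "\<Phi> (presented_class B_rels p) = ?h p" for p
    using H.the_elem_simp[of p] unfolding \<Phi>_def presented_class_def ker by simp
  have comp: "\<Phi> ` pres_comp J = B_comp J" for J
  proof (intro equalityI subsetI)
    fix F assume "F \<in> \<Phi> ` pres_comp J"
    then obtain p where p: "F = ?h p"
      and J: "\<forall>m\<in>Poly_Mapping.keys p. {n. odd (Poly_Mapping.lookup m n)} = fset J"
      by (auto simp: pres_comp_def \<Phi>)
    have "to_group_ring p = Poly_Mapping.single J (Poly_Mapping.lookup (to_group_ring p) J)"
    proof (rule poly_mapping_eqI)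
      have odd_support: "odd_support m = J" if "m \<in> Poly_Mapping.keys p" for m
        using J that by (intro fset_inject[THEN iffD1]) (simp add: fset_odd_support)
      fix K
      show "Poly_Mapping.lookup (to_group_ring p) K
          = Poly_Mapping.lookup (Poly_Mapping.single J (Poly_Mapping.lookup (to_group_ring p) J)) K"
        by (auto simp: to_group_ring_def lin_ext_def lookup_sum lookup_single when_def odd_support)
    qed
    moreover obtain w where "Poly_Mapping.lookup (to_group_ring p) J = sqrt_hpoly J * w"
      using sqrt_hpoly_dvd_to_group_ring by (rule dvdE)
    ultimately have "F = B_incl J (left_mult (hpoly J * w))"
      using p B_elem_single[of J "sqrt_hpoly J * w"] by (metis mult.assoc sqrt_hpoly_square)
    then show "F \<in> B_comp J" by (auto simp: B_comp_def B_hom_eq)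
  next
    fix F :: "int fset \<Rightarrow> 'k qgr \<Rightarrow> 'k qgr" assume "F \<in> B_comp J"
    then obtain w where F: "F = B_incl J (left_mult (hpoly J * w))" by (auto simp: B_comp_def B_hom_eq)
    let ?p = "Poly_Mapping.single (squarefree_exp J) w"
    have "F = ?h ?p" by (simp add: F to_group_ring_single B_elem_single mult_ac flip: sqrt_hpoly_square)
    moreover have "\<forall>m\<in>Poly_Mapping.keys ?p. {n. odd (Poly_Mapping.lookup m n)} = fset J"
      using fset_odd_support[of "squarefree_exp J"] by simp
    ultimately show "F \<in> \<Phi> ` pres_comp J"
      unfolding pres_comp_def \<Phi>[symmetric] by blast
  qed
  have "\<Phi> (presented_class B_rels (bconst c)) = B_incl {||} (left_mult c)" for c
    by (simp add: \<Phi> to_group_ring_bconst B_elem_single flip: zero_fset_def)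
  moreover have "\<Phi> (presented_class B_rels (bvar n)) = B_incl {|n|} (left_mult (hpoly {|n|}))" for n
    by (simp add: \<Phi> to_group_ring_bvar B_elem_single flip: sqrt_hpoly_square)
  ultimately show ?thesis using ring iso comp by blast
qed

end
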